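(* Let $f$ be a nonconstant entire function on $\mathbb{C}$, let $n\geq 2$ be an integer, and let $F=f^{n}$. If $F$ and $F'$ share $1$ CM, then $F\equiv F'$, and $f$ has the form $$f(z)=ce^{z/n},$$ where $c$ is a nonzero constant.
   Context: Two entire functions $F$ and $G$ share the value $1$ CM (counting multiplicities) if $F-1$ and $G-1$ have the same zeros with the same multiplicities. *)

theory Defs
  imports "HOL-Complex_Analysis.Complex_Analysis"
begin

(* Meant for entire F and G. The value of zorder at a zero is the multiplicity of that zero
   only if the function does not vanish identically. If one of F and G is identically a, the
   first conjunct forces the other one to be so too, and then the two zorder terms coincide. *)
definition share_CM :: "complex \<Rightarrow> (complex \<Rightarrow> complex) \<Rightarrow> (complex \<Rightarrow> complex) \<Rightarrow> bool" where
  "share_CM a F G \<longleftrightarrow>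
     (\<forall>z. F z - a = 0 \<longleftrightarrow> G z - a = 0) \<and>
     (\<forall>z. F z - a = 0 \<longrightarrow> zorder (\<lambda>w. F w - a) z = zorder (\<lambda>w. G w - a) z)"

end

theory Submission
  imports Defs "HOL-Real_Asymp.Real_Asymp"
begin

text \<open>
  Since \<open>n \<ge> 2\<close>, zeros of \<open>F\<close> are zeros of \<open>F'\<close>. If the spherical derivative of \<open>F\<close> were
  unbounded, rescalings \<open>F (z\<^sub>j + \<rho>\<^sub>j \<zeta>) / \<rho>\<^sub>j\<close> would converge to a nonconstant entire function \<open>g\<close> of
  exponential type all of whose zeros are multiple; as \<open>F' = 1\<close> forces \<open>F = 1\<close>, that is, value
  \<open>1 / \<rho>\<^sub>j \<rightarrow> \<infinity>\<close> for the rescaling, \<open>g'\<close> omits \<open>1\<close>. Then \<open>g' = 1 + exp (a z + b)\<close>, which is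
  impossible. So the spherical derivative is bounded, and \<open>F\<close> has exponential type by an argument of
  Clunie and Hayman: at a point where \<open>\<bar>F\<bar> = 1\<close> the gradient of \<open>log \<bar>F\<bar>\<close> is bounded, and Harnack's
  inequality in a disc of \<open>{\<bar>F\<bar> > 1}\<close> touching such a point bounds \<open>log \<bar>F\<bar>\<close> at its centre by a
  multiple of the radius.

  Sharing \<open>1\<close> CM gives \<open>F' - 1 = exp \<alpha> * (F - 1)\<close>, and comparing growth after division by the common
  zeros shows that \<open>\<alpha> = a z + b\<close>. If \<open>a \<noteq> 0\<close>, normalise to \<open>a \<Phi>' - 1 = exp z * (\<Phi> - 1)\<close>: exponential
  type forces \<open>\<Phi>\<close> to have period \<open>2 \<pi> i\<close>, and the integrals of \<open>exp (k z) * \<Phi>\<close> over a period never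
  vanish for \<open>k \<ge> 1\<close> by a recurrence in \<open>k\<close>, but vanish for large \<open>k\<close> by growth. If \<open>a = 0\<close>, the equation
  is solved explicitly.
\<close>

section \<open>Positive harmonic functions and the modulus of a holomorphic function\<close>

text \<open>The Schwarz lemma for \<open>\<psi>\<close> followed by the Cayley map
  \<open>(w - \<psi> z0) / (w + cnj (\<psi> z0))\<close>, which takes the right half-plane to the
  unit disc and \<open>\<psi> z0\<close> to \<open>0\<close>.\<close>

lemma schwarz_half_plane:
  assumes hol: "\<psi> holomorphic_on ball z0 R" and "0 < R"
    and pos: "\<And>z. z \<in> ball z0 R \<Longrightarrow> 0 < Re (\<psi> z)" and z: "z \<in> ball z0 R"
  shows "cmod (\<psi> z - \<psi> z0) \<le> dist z0 z / R * cmod (\<psi> z + cnj (\<psi> z0))"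
proof -
  define m where "m \<zeta> = z0 + of_real R * \<zeta>" for \<zeta> :: complex
  have m: "m \<zeta> \<in> ball z0 R" if "cmod \<zeta> < 1" for \<zeta>
    using that \<open>0 < R\<close> by (simp add: m_def dist_norm norm_mult)
  define f where "f \<zeta> = (\<psi> (m \<zeta>) - \<psi> z0) / (\<psi> (m \<zeta>) + cnj (\<psi> z0))" for \<zeta>
  have z0: "0 < Re (\<psi> z0)" using pos[of z0] \<open>0 < R\<close> by simp
  have nz: "\<psi> (m \<zeta>) + cnj (\<psi> z0) \<noteq> 0" if "cmod \<zeta> < 1" for \<zeta>
  proof -
    have "0 < Re (\<psi> (m \<zeta>) + cnj (\<psi> z0))" using pos[OF m[OF that]] z0 by simp
    then show ?thesis by force
  qed
  have sq: "(cmod (w + cnj v))\<^sup>2 - (cmod (w - v))\<^sup>2 = 4 * Re w * Re v" for w v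
    unfolding cmod_power2 by (simp add: power2_eq_square algebra_simps)
  have lt: "cmod (f \<zeta>) < 1" if "cmod \<zeta> < 1" for \<zeta>
  proof -
    have "0 < 4 * Re (\<psi> (m \<zeta>)) * Re (\<psi> z0)"
      using z0 pos[OF m[OF that]] by simp
    then have "(cmod (\<psi> (m \<zeta>) - \<psi> z0))\<^sup>2 < (cmod (\<psi> (m \<zeta>) + cnj (\<psi> z0)))\<^sup>2"
      using sq[of "\<psi> (m \<zeta>)" "\<psi> z0"] by linarith
    then have "cmod (\<psi> (m \<zeta>) - \<psi> z0) < cmod (\<psi> (m \<zeta>) + cnj (\<psi> z0))"
      by (rule power2_less_imp_less) simp
    then show ?thesis
      using nz[OF that] by (simp add: f_def norm_divide)
  qed
  have "m ` ball 0 1 \<subseteq> ball z0 R" using m by auto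
  moreover have "m holomorphic_on ball 0 1" unfolding m_def by (intro holomorphic_intros)
  ultimately have "\<psi> \<circ> m holomorphic_on ball 0 1"
    using hol holomorphic_on_compose_gen by blast
  then have "f holomorphic_on ball 0 1"
    unfolding f_def o_def using nz by (intro holomorphic_intros) auto
  moreover have "f 0 = 0" by (simp add: f_def m_def)
  moreover have n: "cmod ((z - z0) / R) < 1"
    using z \<open>0 < R\<close> by (simp add: norm_divide dist_norm norm_minus_commute)
  ultimately have "cmod (f ((z - z0) / R)) \<le> cmod ((z - z0) / R)"
    using lt Schwarz_Lemma(1) by blast
  moreover have "m ((z - z0) / R) = z" using \<open>0 < R\<close> by (simp add: m_def)
  ultimately show ?thesis
    using nz[OF n] \<open>0 < R\<close>
    by (simp add: f_def norm_divide pos_divide_le_eq dist_norm norm_minus_commute)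
qed

text \<open>A non-sharp Harnack inequality, obtained by squaring the Schwarz estimate and using
  \<open>p \<le> X\<close>. Only the linear decay in the distance to the boundary matters
  later.\<close>

lemma harnack_half_plane:
  assumes "\<psi> holomorphic_on ball z0 R" "0 < R"
    and pos: "\<And>z. z \<in> ball z0 R \<Longrightarrow> 0 < Re (\<psi> z)" and z: "z \<in> ball z0 R"
  shows "Re (\<psi> z0) * (1 - dist z0 z / R) / 4 \<le> Re (\<psi> z)"
proof -
  define s where "s = dist z0 z / R"
  have s: "0 \<le> s" "s < 1" using z \<open>0 < R\<close> by (auto simp: s_def)
  define x p X where "x = Re (\<psi> z)" and "p = Re (\<psi> z0)" and "X = cmod (\<psi> z + cnj (\<psi> z0))"
  have xp: "0 < x" "0 < p" using pos[OF z] pos[of z0] \<open>0 < R\<close> by (auto simp: x_def p_def)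
  have "cmod (\<psi> z - \<psi> z0) \<le> s * X"
    unfolding s_def X_def by (rule schwarz_half_plane[OF assms])
  then have "(cmod (\<psi> z - \<psi> z0))\<^sup>2 \<le> s\<^sup>2 * X\<^sup>2"
    by (metis norm_ge_zero power_mono power_mult_distrib)
  moreover have "X\<^sup>2 - (cmod (\<psi> z - \<psi> z0))\<^sup>2 = 4 * x * p"
    unfolding X_def x_def p_def cmod_power2 by (simp add: power2_eq_square algebra_simps)
  ultimately have 1: "X\<^sup>2 * (1 - s\<^sup>2) \<le> 4 * x * p" by (simp add: algebra_simps)
  have "x + p \<le> X" unfolding X_def x_def p_def
    using complex_Re_le_cmod[of "\<psi> z + cnj (\<psi> z0)"] by simp
  then have "p \<le> X" using xp by simp
  then have "p\<^sup>2 \<le> X\<^sup>2" using xp by (intro power_mono) auto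
  moreover have "s\<^sup>2 \<le> s" using s by (simp add: power2_eq_square mult_left_le)
  ultimately have "p\<^sup>2 * (1 - s) \<le> X\<^sup>2 * (1 - s\<^sup>2)"
    using s by (intro mult_mono) auto
  with 1 have "p * (p * (1 - s)) \<le> p * (4 * x)" by (simp add: power2_eq_square algebra_simps)
  then have "p * (1 - s) \<le> 4 * x" using xp by simp
  then show ?thesis by (simp add: p_def s_def x_def)
qed

text \<open>The triangle inequality bounds the last factor of the Schwarz estimate by
  \<open>cmod (\<psi> z - \<psi> z0) + 2 * Re (\<psi> z0)\<close>; it remains to solve for the
  difference.\<close>

lemma borel_caratheodory_half_plane:
  assumes "\<psi> holomorphic_on ball z0 R" "0 < R"
    and pos: "\<And>z. z \<in> ball z0 R \<Longrightarrow> 0 < Re (\<psi> z)" and z: "z \<in> ball z0 R"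
  shows "cmod (\<psi> z - \<psi> z0) * (R - dist z0 z) \<le> 2 * Re (\<psi> z0) * dist z0 z"
proof -
  have p: "0 < Re (\<psi> z0)" using pos[of z0] \<open>0 < R\<close> by simp
  have "\<psi> z + cnj (\<psi> z0) = (\<psi> z - \<psi> z0) + of_real (2 * Re (\<psi> z0))"
    by (simp add: complex_eq_iff)
  then have "cmod (\<psi> z + cnj (\<psi> z0)) \<le> cmod (\<psi> z - \<psi> z0) + 2 * Re (\<psi> z0)"
    using norm_triangle_ineq[of "\<psi> z - \<psi> z0" "of_real (2 * Re (\<psi> z0))"] p
    by (simp only: norm_of_real)
  then have "dist z0 z / R * cmod (\<psi> z + cnj (\<psi> z0))
      \<le> dist z0 z / R * (cmod (\<psi> z - \<psi> z0) + 2 * Re (\<psi> z0))"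
    using \<open>0 < R\<close> by (intro mult_left_mono) auto
  with schwarz_half_plane[OF assms]
  have "cmod (\<psi> z - \<psi> z0) \<le> dist z0 z / R * (cmod (\<psi> z - \<psi> z0) + 2 * Re (\<psi> z0))"
    by linarith
  then show ?thesis using \<open>0 < R\<close> by (simp add: field_simps)
qed

lemma deriv_half_plane:
  assumes "\<psi> holomorphic_on ball z0 R" "0 < R"
    and pos: "\<And>z. z \<in> ball z0 R \<Longrightarrow> 0 < Re (\<psi> z)"
  shows "R * cmod (deriv \<psi> z0) \<le> 2 * Re (\<psi> z0)"
proof -
  have "(\<psi> has_field_derivative deriv \<psi> z0) (at z0)"
    using assms by (intro holomorphic_derivI[of _ "ball z0 R"]) auto
  then have "((\<lambda>z. (\<psi> z - \<psi> z0) / (z - z0)) \<longlongrightarrow> deriv \<psi> z0) (at z0)"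
    by (simp add: has_field_derivative_iff)
  then have "((\<lambda>z. cmod ((\<psi> z - \<psi> z0) / (z - z0)) * (R - dist z0 z)) \<longlongrightarrow>
      cmod (deriv \<psi> z0) * (R - dist z0 z0)) (at z0)"
    by (intro tendsto_intros)
  moreover have "\<forall>\<^sub>F z in at z0. cmod ((\<psi> z - \<psi> z0) / (z - z0)) * (R - dist z0 z) \<le> 2 * Re (\<psi> z0)"
  proof -
    have "\<forall>\<^sub>F z in at z0. z \<in> ball z0 R" using \<open>0 < R\<close>
      by (intro eventually_at_in_open') auto
    moreover have "\<forall>\<^sub>F z in at z0. z \<noteq> z0" by (rule eventually_neq_at_within)
    ultimately show ?thesis
    proof eventually_elim
      case (elim z)
      then show ?case
        using borel_caratheodory_half_plane[OF assms elim(1)]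
        by (simp add: norm_divide dist_norm norm_minus_commute pos_divide_le_eq)
    qed
  qed
  ultimately have "cmod (deriv \<psi> z0) * (R - dist z0 z0) \<le> 2 * Re (\<psi> z0)"
    by (rule tendsto_upperbound) auto
  then show ?thesis by (simp add: mult.commute)
qed

lemma holomorphic_log_ball:
  assumes "g holomorphic_on ball z0 d" "\<And>z. z \<in> ball z0 d \<Longrightarrow> g z \<noteq> 0"
  shows "\<exists>\<phi>. \<phi> holomorphic_on ball z0 d \<and> (\<forall>z\<in>ball z0 d. g z = exp (\<phi> z))"
proof -
  have "contractible (ball z0 d)" by (simp add: convex_imp_contractible)
  from contractible_imp_holomorphic_log[OF assms(1) this assms(2)] show ?thesis
    by metis
qed

text \<open>A Hopf boundary lemma. In the ball \<open>ln (cmod (g z) / A)\<close> is positive and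
  harmonic, and it vanishes at \<open>z1\<close>; by Harnack it grows at least linearly along the
  radius from \<open>z1\<close> to \<open>z0\<close>, which bounds \<open>deriv g z1\<close> from
  below.\<close>

lemma log_modulus_le_boundary_deriv:
  assumes hol: "g holomorphic_on S" "open S" "cball z0 d \<subseteq> S" and "0 < d" "0 < A"
    and gt: "\<And>z. z \<in> ball z0 d \<Longrightarrow> A < cmod (g z)"
    and z1: "dist z0 z1 = d" "cmod (g z1) = A"
  shows "A * ln (cmod (g z0) / A) \<le> 4 * d * cmod (deriv g z1)"
proof -
  have "(\<lambda>z. g z / of_real A) holomorphic_on ball z0 d"
    using holomorphic_on_subset[OF hol(1)] hol(3) \<open>0 < A\<close> ball_subset_cball
    by (intro holomorphic_intros) (blast, simp)
  moreover have "g z / of_real A \<noteq> 0" if "z \<in> ball z0 d" for z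
    using gt[OF that] \<open>0 < A\<close> by force
  ultimately obtain \<phi> where \<phi>: "\<phi> holomorphic_on ball z0 d"
    "\<And>z. z \<in> ball z0 d \<Longrightarrow> g z / of_real A = exp (\<phi> z)"
    using holomorphic_log_ball[of "\<lambda>z. g z / of_real A" z0 d] by blast
  have mod: "cmod (g z) = A * exp (Re (\<phi> z))" if "z \<in> ball z0 d" for z
  proof -
    have "g z = of_real A * exp (\<phi> z)" using \<phi>(2)[OF that] \<open>0 < A\<close> by (simp add: field_simps)
    then show ?thesis using \<open>0 < A\<close> by (simp add: norm_mult)
  qed
  have pos: "0 < Re (\<phi> z)" if "z \<in> ball z0 d" for z
    using mod[OF that] gt[OF that] \<open>0 < A\<close> by simp
  define p where "p = Re (\<phi> z0)"
  have p: "ln (cmod (g z0) / A) = p"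
    using mod[of z0] \<open>0 < d\<close> \<open>0 < A\<close> by (simp add: p_def)
  \<comment> \<open>\<open>m\<close> follows the radius from \<open>z1\<close> at
    \<open>t = 0\<close> to \<open>z0\<close> at \<open>t = 1\<close>, so the Harnack factor
    \<open>1 - dist z0 (m t) / d\<close> is \<open>t\<close>.\<close>
  define m where "m t = z1 + of_real t * (z0 - z1)" for t :: real
  have lower: "A * p / 4 \<le> cmod ((g (m t) - g z1) / (m t - z1)) * d" if t: "0 < t" "t < 1" for t
  proof -
    have "z0 - m t = of_real (1 - t) * (z0 - z1)"
      by (simp add: m_def algebra_simps)
    then have "dist z0 (m t) = cmod (of_real (1 - t)) * cmod (z0 - z1)"
      by (simp only: dist_norm norm_mult)
    also have "\<dots> = (1 - t) * d" using t z1 by (simp only: norm_of_real dist_norm)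
    finally have dt: "dist z0 (m t) = (1 - t) * d" .
    then have mb: "m t \<in> ball z0 d" using t \<open>0 < d\<close> by simp
    have "p * t / 4 \<le> Re (\<phi> (m t))"
      using harnack_half_plane[OF \<phi>(1) \<open>0 < d\<close> pos mb] dt \<open>0 < d\<close> by (simp add: p_def)
    also have "\<dots> \<le> exp (Re (\<phi> (m t))) - 1" by (smt (verit) exp_ge_add_one_self)
    finally have "A * (p * t / 4) \<le> A * (exp (Re (\<phi> (m t))) - 1)"
      using \<open>0 < A\<close> by (intro mult_left_mono) auto
    also have "\<dots> = cmod (g (m t)) - cmod (g z1)"
      using mod[OF mb] z1 by (simp add: algebra_simps)
    also have "\<dots> \<le> cmod (g (m t) - g z1)"
      using norm_triangle_ineq2[of "g (m t)" "g z1"] by simp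
    finally have "A * p / 4 \<le> cmod (g (m t) - g z1) / t" using t by (simp add: field_simps)
    also have "cmod (m t - z1) = t * d" using t z1
      by (simp add: m_def norm_mult dist_norm)
    then have "cmod (g (m t) - g z1) / t = cmod ((g (m t) - g z1) / (m t - z1)) * d"
      using t \<open>0 < d\<close> by (simp add: norm_divide)
    finally show ?thesis .
  qed
  have "z1 \<in> S" using hol(3) z1 by auto
  then have "(g has_field_derivative deriv g z1) (at z1)"
    using holomorphic_derivI hol by blast
  then have "((\<lambda>z. (g z - g z1) / (z - z1)) \<longlongrightarrow> deriv g z1) (at z1)"
    by (simp add: has_field_derivative_iff)
  moreover have "filterlim m (at z1) (at_right 0)"
  proof (rule filterlim_atI)
    have "(m \<longlongrightarrow> z1 + of_real 0 * (z0 - z1)) (at_right 0)"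
      unfolding m_def by (intro tendsto_intros)
    then show "(m \<longlongrightarrow> z1) (at_right 0)" by simp
    have "z0 \<noteq> z1" using z1 \<open>0 < d\<close> by auto
    then have "m t \<noteq> z1" if "t > 0" for t using that by (simp add: m_def)
    then show "\<forall>\<^sub>F t in at_right 0. m t \<noteq> z1"
      by (rule eventually_mono[OF eventually_at_right_less])
  qed
  ultimately have "((\<lambda>t. (g (m t) - g z1) / (m t - z1)) \<longlongrightarrow> deriv g z1) (at_right 0)"
    by (rule filterlim_compose)
  then have "((\<lambda>t. cmod ((g (m t) - g z1) / (m t - z1)) * d) \<longlongrightarrow> cmod (deriv g z1) * d) (at_right 0)"
    by (intro tendsto_intros)
  moreover have "\<forall>\<^sub>F t in at_right 0. A * p / 4 \<le> cmod ((g (m t) - g z1) / (m t - z1)) * d"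
    using eventually_at_right_real[of 0 1] lower by (auto elim: eventually_mono)
  ultimately have "A * p / 4 \<le> cmod (deriv g z1) * d"
    by (rule tendsto_lowerbound) auto
  then show ?thesis using p by (simp add: algebra_simps)
qed

text \<open>Take a point \<open>z1\<close> of \<open>{cmod g \<le> A}\<close> nearest to
  \<open>z0\<close>. The open disc about \<open>z0\<close> reaching to \<open>z1\<close> lies in
  \<open>{cmod g > A}\<close>, so the boundary lemma applies at \<open>z1\<close>; the radius is at
  most \<open>dist z0 w\<close> because \<open>w\<close> competes.\<close>

lemma modulus_le_exp_dist:
  assumes hol: "g holomorphic_on S" "open S" "cball z0 (dist z0 w) \<subseteq> S" and "0 < A"
    and w: "cmod (g w) \<le> A"
    and L: "\<And>z. z \<in> S \<Longrightarrow> cmod (g z) = A \<Longrightarrow> cmod (deriv g z) \<le> L"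
    and "0 \<le> L"
  shows "cmod (g z0) \<le> A * exp (4 * L * dist z0 w / A)"
proof (cases "A < cmod (g z0)")
  case big: True
    define K where "K = {z \<in> cball z0 (dist z0 w). cmod (g z) \<le> A}"
    have cont: "continuous_on S g" using hol holomorphic_on_imp_continuous_on by blast
    have "continuous_on (cball z0 (dist z0 w)) (\<lambda>z. cmod (g z))"
      using continuous_on_subset[OF cont hol(3)] by (rule continuous_on_norm)
    then have "closed K" unfolding K_def
      by (intro continuous_on_closed_Collect_le continuous_on_const closed_cball)
    moreover have "w \<in> K" using w by (auto simp: K_def)
    ultimately obtain z1 where z1: "z1 \<in> K" "\<And>z. z \<in> K \<Longrightarrow> dist z0 z1 \<le> dist z0 z"
      using distance_attains_inf[of K z0] by blast
    define d where "d = dist z0 z1"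
    have d: "0 < d" "d \<le> dist z0 w" using z1 \<open>w \<in> K\<close> big by (auto simp: d_def K_def)
    have sub: "cball z0 d \<subseteq> S" using d hol(3) by auto
    have gt: "A < cmod (g z)" if "z \<in> ball z0 d" for z
    proof (rule ccontr)
      assume "\<not> A < cmod (g z)"
      then have "z \<in> K" using that d sub by (auto simp: K_def)
      then show False using z1(2)[of z] that by (simp add: d_def)
    qed
    \<comment> \<open>\<open>z1\<close> is a limit of points with \<open>cmod (g z) > A\<close> and
      also lies in \<open>K\<close>, so equality holds there.\<close>
    have "z1 \<in> closure (ball z0 d)" using d by (simp add: d_def)
    moreover have "continuous_on (closure (ball z0 d)) (\<lambda>z. cmod (g z))"
      using continuous_on_subset[OF cont sub] d by (simp add: continuous_on_norm)
    ultimately have "A \<le> cmod (g z1)"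
      using continuous_ge_on_closure[of "ball z0 d" "\<lambda>z. cmod (g z)" z1 A] gt by (simp add: less_imp_le)
    then have eq: "cmod (g z1) = A" using z1 by (simp add: K_def)
    have "A * ln (cmod (g z0) / A) \<le> 4 * d * cmod (deriv g z1)"
      by (rule log_modulus_le_boundary_deriv[OF hol(1,2) sub d(1) \<open>0 < A\<close> gt _ eq])
         (auto simp: d_def)
    also have "z1 \<in> S" using z1 hol(3) by (auto simp: K_def)
    then have L1: "cmod (deriv g z1) \<le> L" using L eq by blast
    then have "4 * d * cmod (deriv g z1) \<le> 4 * dist z0 w * L"
      using L1 d \<open>0 \<le> L\<close> by (intro mult_mono) auto
    finally have "ln (cmod (g z0) / A) \<le> 4 * L * dist z0 w / A"
      using \<open>0 < A\<close> by (simp add: field_simps)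
    then have "exp (ln (cmod (g z0) / A)) \<le> exp (4 * L * dist z0 w / A)" by (rule iffD2[OF exp_le_cancel_iff])
    moreover have "0 < cmod (g z0) / A" using big \<open>0 < A\<close> by (intro divide_pos_pos) auto
    ultimately have "cmod (g z0) / A \<le> exp (4 * L * dist z0 w / A)"
      by (simp only: exp_ln)
    then show ?thesis using \<open>0 < A\<close> by (simp add: field_simps)
next
  case False
  moreover have "A \<le> A * exp (4 * L * dist z0 w / A)"
    using \<open>0 < A\<close> \<open>0 \<le> L\<close> by simp
  ultimately show ?thesis by linarith
qed

section \<open>Entire functions of exponential type\<close>

lemma deriv_zero_imp_eq:
  assumes "\<And>z. (V has_field_derivative 0) (at z)"
  shows "V (x :: complex) = (V y :: complex)"
  using has_field_derivative_zero_constant[of UNIV V] assms by (metis UNIV_I convex_UNIV)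

text \<open>Order one and finite type. A single \<open>C\<close> covers every bound
  \<open>exp (A + B * cmod z)\<close>; see \<open>exp_typeI\<close>.\<close>

definition exp_type :: "(complex \<Rightarrow> complex) \<Rightarrow> bool" where
  "exp_type g \<longleftrightarrow> (\<exists>C. \<forall>z. cmod (g z) \<le> exp (C * (1 + cmod z)))"

lemma exp_typeE:
  assumes "exp_type g"
  obtains C where "0 \<le> C" "\<And>z. cmod (g z) \<le> exp (C * (1 + cmod z))"
proof -
  obtain C where C: "\<And>z. cmod (g z) \<le> exp (C * (1 + cmod z))"
    using assms by (auto simp: exp_type_def)
  have "cmod (g z) \<le> exp (\<bar>C\<bar> * (1 + cmod z))" for z
  proof -
    have "C * (1 + cmod z) \<le> \<bar>C\<bar> * (1 + cmod z)" by (intro mult_right_mono) auto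
    then have "exp (C * (1 + cmod z)) \<le> exp (\<bar>C\<bar> * (1 + cmod z))" by (rule iffD2[OF exp_le_cancel_iff])
    then show ?thesis using C[of z] by linarith
  qed
  then show ?thesis using that[of "\<bar>C\<bar>"] by auto
qed

lemma exp_typeI:
  assumes "\<And>z. cmod (g z) \<le> exp (A + B * cmod z)" and "0 \<le> B"
  shows "exp_type g"
  unfolding exp_type_def
proof (intro exI allI)
  fix z
  have "0 \<le> \<bar>A\<bar> * cmod z" by simp
  then have "A + B * cmod z \<le> (\<bar>A\<bar> + B) * (1 + cmod z)"
    using \<open>0 \<le> B\<close> abs_ge_self[of A] unfolding distrib_left distrib_right by linarith
  then have "exp (A + B * cmod z) \<le> exp ((\<bar>A\<bar> + B) * (1 + cmod z))" by (rule iffD2[OF exp_le_cancel_iff])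
  then show "cmod (g z) \<le> exp ((\<bar>A\<bar> + B) * (1 + cmod z))" using assms(1)[of z] by linarith
qed

lemma exp_type_const: "exp_type (\<lambda>_. c)"
proof (rule exp_typeI[where A = "cmod c" and B = 0])
  show "cmod c \<le> exp (cmod c + 0 * cmod z)" for z
    using exp_ge_add_one_self[of "cmod c"] by (simp del: exp_ge_add_one_self)
qed simp

lemma exp_type_diff:
  assumes "exp_type f" "exp_type g"
  shows "exp_type (\<lambda>z. f z - g z)"
proof -
  obtain C D where C: "0 \<le> C" "\<And>z. cmod (f z) \<le> exp (C * (1 + cmod z))"
    and D: "0 \<le> D" "\<And>z. cmod (g z) \<le> exp (D * (1 + cmod z))"
    using exp_typeE[OF assms(1)] exp_typeE[OF assms(2)] by metis
  show ?thesis
  proof (rule exp_typeI)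
    fix z
    let ?E = "exp ((C + D) * (1 + cmod z))"
    have "C * (1 + cmod z) \<le> (C + D) * (1 + cmod z)" "D * (1 + cmod z) \<le> (C + D) * (1 + cmod z)"
      using C D by (auto intro!: mult_right_mono)
    then have "exp (C * (1 + cmod z)) \<le> ?E" "exp (D * (1 + cmod z)) \<le> ?E"
      by (simp_all only: exp_le_cancel_iff)
    then have "cmod (f z - g z) \<le> 2 * ?E"
      using C(2)[of z] D(2)[of z] norm_triangle_ineq4[of "f z" "g z"] by linarith
    also have "\<dots> \<le> exp 1 * ?E"
      using exp_ge_add_one_self[of "1::real"] by (intro mult_right_mono) auto
    also have "\<dots> = exp ((1 + (C + D)) + (C + D) * cmod z)"
      by (simp add: exp_add[symmetric] algebra_simps)
    finally show "cmod (f z - g z) \<le> \<dots>" .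
  qed (use C D in auto)
qed

lemma exp_type_affine:
  assumes "exp_type f"
  shows "exp_type (\<lambda>z. f (a * z + b))"
proof -
  obtain C where C: "0 \<le> C" "\<And>z. cmod (f z) \<le> exp (C * (1 + cmod z))"
    using assms by (metis exp_typeE)
  show ?thesis
  proof (rule exp_typeI)
    fix z
    have "cmod (a * z + b) \<le> cmod a * cmod z + cmod b"
      by (metis norm_mult norm_triangle_ineq)
    then have "C * (1 + cmod (a * z + b)) \<le> C * (1 + (cmod a * cmod z + cmod b))"
      using C by (intro mult_left_mono) auto
    also have "\<dots> = C * (1 + cmod b) + (C * cmod a) * cmod z" by (simp add: algebra_simps)
    finally have "exp (C * (1 + cmod (a * z + b))) \<le> exp \<dots>" by (rule iffD2[OF exp_le_cancel_iff])
    then show "cmod (f (a * z + b)) \<le> exp (C * (1 + cmod b) + (C * cmod a) * cmod z)"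
      using C(2)[of "a * z + b"] by linarith
  qed (use C in auto)
qed

lemma exp_type_deriv:
  assumes "exp_type f" "f holomorphic_on UNIV"
  shows "exp_type (deriv f)"
proof -
  obtain C where C: "0 \<le> C" "\<And>z. cmod (f z) \<le> exp (C * (1 + cmod z))"
    using assms by (metis exp_typeE)
  show ?thesis
  proof (rule exp_typeI)
    fix z
    have "cmod ((deriv ^^ 1) f z) \<le> fact 1 * exp (2 * C + C * cmod z) / 1 ^ 1"
    proof (rule Cauchy_inequality)
      show "f holomorphic_on ball z 1" using assms holomorphic_on_subset by blast
      show "continuous_on (cball z 1) f"
        using assms holomorphic_on_subset holomorphic_on_imp_continuous_on by blast
      fix x assume "cmod (z - x) = 1"
      then have "cmod x \<le> 1 + cmod z"
        using norm_triangle_ineq2[of x z] by (simp add: norm_minus_commute)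
      then have "C * (1 + cmod x) \<le> C * (1 + (1 + cmod z))" using C by (intro mult_left_mono) auto
      also have "\<dots> = 2 * C + C * cmod z" by (simp add: algebra_simps)
      finally have "exp (C * (1 + cmod x)) \<le> exp (2 * C + C * cmod z)" by (rule iffD2[OF exp_le_cancel_iff])
      then show "cmod (f x) \<le> exp (2 * C + C * cmod z)" using C(2)[of x] by linarith
    qed simp
    then show "cmod (deriv f z) \<le> exp (2 * C + C * cmod z)" by simp
  qed (use C in auto)
qed

text \<open>Where \<open>cmod (g z) = 1\<close> the derivative is at most \<open>2 * L\<close>, so
  growth can be measured from any \<open>w\<close> with \<open>cmod (g w) \<le> 1\<close>. Without
  such a point \<open>1 / g\<close> is bounded and Liouville makes \<open>g\<close>
  constant.\<close>

lemma exp_type_of_spherical_deriv_bound: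
  assumes hol: "g holomorphic_on UNIV"
    and "\<And>z. cmod (deriv g z) \<le> L * (1 + (cmod (g z))\<^sup>2)"
  shows "exp_type g"
proof -
  have "0 \<le> L"
  proof -
    have "0 \<le> L * (1 + (cmod (g 0))\<^sup>2)" using assms(2)[of 0] norm_ge_zero order_trans by blast
    moreover have "0 < 1 + (cmod (g 0))\<^sup>2" by (smt (verit) zero_le_power2)
    ultimately show ?thesis by (simp add: zero_le_mult_iff)
  qed
  show ?thesis
  proof (cases "\<exists>w. cmod (g w) \<le> 1")
    case True
    then obtain w where w: "cmod (g w) \<le> 1" by blast
    show ?thesis
    proof (rule exp_typeI)
      fix z
      have "cmod (g z) \<le> 1 * exp (4 * (2 * L) * dist z w / 1)"
        using assms(2) \<open>0 \<le> L\<close>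
        by (intro modulus_le_exp_dist[OF hol _ _ _ w]) (auto simp: mult.commute, metis mult.commute one_add_one one_power2)
      also have "dist z w \<le> cmod w + cmod z"
        using norm_triangle_ineq4[of z w] by (simp add: dist_norm)
      then have "8 * L * dist z w \<le> 8 * L * (cmod w + cmod z)"
        using \<open>0 \<le> L\<close> by (intro mult_left_mono) auto
      then have "1 * exp (4 * (2 * L) * dist z w / 1) \<le> exp (8 * L * cmod w + (8 * L) * cmod z)"
        by (simp add: algebra_simps)
      finally show "cmod (g z) \<le> exp (8 * L * cmod w + (8 * L) * cmod z)" .
    qed (use \<open>0 \<le> L\<close> in simp)
  next
    case False
    then have big: "cmod (g z) > 1" for z by (meson not_le)
    then have "g z \<noteq> 0" for z by (metis norm_zero not_one_less_zero)
    then have "(\<lambda>z. 1 / g z) holomorphic_on UNIV" using hol by (intro holomorphic_intros) auto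
    moreover have "bounded (range (\<lambda>z. 1 / g z))"
    proof -
      have "cmod (1 / g z) \<le> 1" for z using big[of z] by (simp add: norm_divide divide_le_eq_1)
      then show ?thesis by (auto simp: bounded_iff)
    qed
    ultimately obtain c where "\<And>z. 1 / g z = c"
      using Liouville_theorem by (fastforce simp: constant_on_def)
    then have "g = (\<lambda>_. 1 / c)" by (metis divide_divide_eq_right div_by_1 mult_1)
    then show ?thesis using exp_type_const by metis
  qed
qed

text \<open>\<open>L + 1 - \<phi>\<close> maps the disc into the open right half-plane, strictly
  because of the \<open>1\<close>. The radius exceeds \<open>2 * cmod z\<close>, hence
  \<open>cmod z \<le> ?R - cmod z\<close>, and it is positive even at \<open>z = 0\<close>.\<close>

lemma borel_caratheodory:
  fixes z :: complex
  assumes "\<phi> holomorphic_on ball 0 (2 * cmod z + 1)"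
    and le: "\<And>w. w \<in> ball 0 (2 * cmod z + 1) \<Longrightarrow> Re (\<phi> w) \<le> L"
  shows "cmod (\<phi> z - \<phi> 0) \<le> 2 * (L + 1 - Re (\<phi> 0))"
proof -
  define \<psi> where "\<psi> w = of_real (L + 1) - \<phi> w" for w
  let ?R = "2 * cmod z + 1"
  have R: "0 < ?R" by (simp add: add_nonneg_pos)
  have hol: "\<psi> holomorphic_on ball 0 ?R" unfolding \<psi>_def using assms by (intro holomorphic_intros)
  have pos: "0 < Re (\<psi> w)" if "w \<in> ball 0 ?R" for w
    using le[OF that] by (simp add: \<psi>_def)
  have z: "z \<in> ball 0 ?R" using norm_ge_zero[of z] by (simp del: norm_ge_zero)
  have "cmod (\<psi> z - \<psi> 0) * (?R - cmod z) \<le> 2 * Re (\<psi> 0) * cmod z"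
    using borel_caratheodory_half_plane[OF hol R pos z] by simp
  also have "\<dots> \<le> 2 * Re (\<psi> 0) * (?R - cmod z)"
    using pos[of 0] R by (intro mult_left_mono) auto
  finally have "cmod (\<psi> z - \<psi> 0) \<le> 2 * Re (\<psi> 0)"
    by (rule mult_right_le_imp_le) (use norm_ge_zero[of z] in linarith)
  then show ?thesis by (simp add: \<psi>_def norm_minus_commute)
qed

text \<open>\<open>Re \<alpha>\<close> has a linear upper bound, hence by Borel-Caratheodory so has
  \<open>cmod \<alpha>\<close>, and Liouville's theorem for polynomial growth leaves degree at most
  one.\<close>

lemma affine_of_exp_type_exp:
  assumes hol: "\<alpha> holomorphic_on UNIV" and "exp_type (\<lambda>z. exp (\<alpha> z))"
  obtains a b where "\<And>z. \<alpha> z = a * z + b"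
proof -
  obtain C where C: "0 \<le> C" "\<And>z. cmod (exp (\<alpha> z)) \<le> exp (C * (1 + cmod z))"
    using assms by (metis exp_typeE)
  then have re: "Re (\<alpha> z) \<le> C * (1 + cmod z)" for z by simp
  \<comment> \<open>For \<open>1 \<le> cmod z\<close> every constant is absorbed into a multiple of
    \<open>cmod z\<close>; \<open>4 * C\<close> comes from
    \<open>C * (2 + 2 * cmod z)\<close>.\<close>
  define B where "B = cmod (\<alpha> 0) + 2 * (4 * C + 1 + \<bar>Re (\<alpha> 0)\<bar>)"
  have "cmod (\<alpha> z) \<le> B * cmod z ^ 1" if z: "1 \<le> cmod z" for z
  proof -
    have "cmod (\<alpha> z - \<alpha> 0) \<le> 2 * (C * (2 + 2 * cmod z) + 1 - Re (\<alpha> 0))"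
    proof (rule borel_caratheodory)
      show "\<alpha> holomorphic_on ball 0 (2 * cmod z + 1)" using hol holomorphic_on_subset by blast
      fix w :: complex assume "w \<in> ball 0 (2 * cmod z + 1)"
      then have "C * (1 + cmod w) \<le> C * (2 + 2 * cmod z)"
        using C by (intro mult_left_mono) auto
      then show "Re (\<alpha> w) \<le> C * (2 + 2 * cmod z)" using re[of w] by linarith
    qed
    moreover have "cmod (\<alpha> z) \<le> cmod (\<alpha> 0) + cmod (\<alpha> z - \<alpha> 0)"
      by (metis norm_triangle_sub)
    moreover have "- Re (\<alpha> 0) \<le> \<bar>Re (\<alpha> 0)\<bar>" by simp
    ultimately have 1: "cmod (\<alpha> z) \<le> cmod (\<alpha> 0) + 2 * (C * (2 + 2 * cmod z) + (1 + \<bar>Re (\<alpha> 0)\<bar>))"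
      unfolding distrib_left right_diff_distrib by linarith
    have 2: "cmod (\<alpha> 0) \<le> cmod (\<alpha> 0) * cmod z" "1 + \<bar>Re (\<alpha> 0)\<bar> \<le> (1 + \<bar>Re (\<alpha> 0)\<bar>) * cmod z"
      using mult_left_mono[OF z, of "cmod (\<alpha> 0)"] mult_left_mono[OF z, of "1 + \<bar>Re (\<alpha> 0)\<bar>"] by auto
    have 3: "C * (2 + 2 * cmod z) \<le> 4 * C * cmod z"
      using mult_left_mono[OF z, of C] C by (simp add: algebra_simps)
    have "cmod (\<alpha> z) \<le> cmod (\<alpha> 0) * cmod z + 2 * (4 * C * cmod z + (1 + \<bar>Re (\<alpha> 0)\<bar>) * cmod z)"
      by (rule order_trans[OF 1]) (intro add_mono mult_left_mono 2 3, simp)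
    then show ?thesis by (simp add: B_def algebra_simps)
  qed
  then have *: "\<alpha> z = (\<Sum>k\<le>1. (deriv ^^ k) \<alpha> 0 / fact k * z ^ k)" for z
    by (rule Liouville_polynomial[OF hol])
  have "\<alpha> z = deriv \<alpha> 0 * z + \<alpha> 0" for z
    by (rule trans[OF *]) simp
  then show ?thesis by (rule that)
qed

section \<open>Zeros and quotients of entire functions\<close>

lemma zorder_exist_zero_entire:
  assumes "G holomorphic_on UNIV" "G p \<noteq> 0"
  obtains r where "r > 0" "zor_poly G a holomorphic_on cball a r"
    "\<And>w. w \<in> cball a r \<Longrightarrow> G w = zor_poly G a w * (w - a) ^ nat (zorder G a)"
    "\<And>w. w \<in> cball a r \<Longrightarrow> zor_poly G a w \<noteq> 0"
proof -
  have "\<exists>w\<in>UNIV. G w \<noteq> 0" using assms by blast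
  from zorder_exist_zero[OF assms(1) open_UNIV connected_UNIV UNIV_I this, of a]
  show ?thesis using that by blast
qed

lemma finite_zeros_cball:
  assumes "G holomorphic_on UNIV" "G p \<noteq> 0"
  shows "finite {z \<in> cball a R. G z = 0}"
proof (cases "G constant_on UNIV")
  case True
  then have "G z \<noteq> 0" for z using assms by (metis UNIV_I constant_on_def)
  then show ?thesis by simp
next
  case False
  then show ?thesis
    using holomorphic_compact_finite_zeros[OF assms(1) open_UNIV connected_UNIV compact_cball subset_UNIV]
    by blast
qed

lemma entire_divide_zero:
  assumes hol: "G holomorphic_on UNIV" and nz: "G p \<noteq> 0"
  obtains h n where "h holomorphic_on UNIV" "h a \<noteq> 0" "\<And>z. G z = (z - a) ^ n * h z"
proof -
  define g n where "g = zor_poly G a" and "n = nat (zorder G a)"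
  obtain r where r: "r > 0" "g holomorphic_on cball a r"
    "\<And>w. w \<in> cball a r \<Longrightarrow> G w = g w * (w - a) ^ n \<and> g w \<noteq> 0"
    using zorder_exist_zero_entire[OF hol nz, of a] unfolding g_def n_def by metis
  \<comment> \<open>Near \<open>a\<close> this coincides with the holomorphic cofactor
    \<open>g\<close>, so the singularity is removable. If \<open>a\<close> is not a zero,
    \<open>n\<close> is \<open>0\<close>.\<close>
  define h where "h z = (if z = a then g a else G z / (z - a) ^ n)" for z
  have hg: "h z = g z" if "z \<in> cball a r" for z
    using r(3)[OF that] by (auto simp: h_def)
  have "h holomorphic_on ball a r"
    by (rule holomorphic_transform[OF holomorphic_on_subset[OF r(2) ball_subset_cball]])
       (use hg in auto)
  moreover have "h holomorphic_on - {a}"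
  proof (rule holomorphic_transform)
    show "(\<lambda>z. G z / (z - a) ^ n) holomorphic_on - {a}"
      using holomorphic_on_subset[OF hol] by (intro holomorphic_intros) auto
  qed (auto simp: h_def)
  ultimately have "h holomorphic_on ball a r \<union> - {a}"
    by (intro holomorphic_on_Un) auto
  moreover have "ball a r \<union> - {a} = UNIV" using r by auto
  moreover have "h a \<noteq> 0" using r(3)[of a] r(1) by (simp add: h_def)
  moreover have "G z = (z - a) ^ n * h z" for z
    using r(3)[of a] r(1) by (cases "z = a") (auto simp: h_def)
  ultimately show ?thesis using that by metis
qed

text \<open>\<open>P\<close> is the product of the factors \<open>1 - z / a\<close>; with this normalisation, division by \<open>P\<close> preserves
  the value at \<open>0\<close> and does not increase the maximum modulus on \<open>\<bar>z\<bar> = 2 R\<close>.\<close>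
lemma entire_split_zeros:
  assumes "G holomorphic_on UNIV" "G 0 \<noteq> 0" and "0 < R"
  shows "\<exists>P H. P holomorphic_on UNIV \<and> H holomorphic_on UNIV \<and> (\<forall>z. G z = P z * H z) \<and> P 0 = 1 \<and>
    (\<forall>z. 2 * R \<le> cmod z \<longrightarrow> 1 \<le> cmod (P z)) \<and> (\<forall>z\<in>cball 0 R. H z \<noteq> 0)"
  using assms(1,2)
\<comment> \<open>The count is of distinct zeros: dividing one out with its full multiplicity lowers
  it by one.\<close>
proof (induction "card {z \<in> cball 0 R. G z = 0}" arbitrary: G)
    case 0
    then have "{z \<in> cball 0 R. G z = 0} = {}"
      using finite_zeros_cball[OF 0(2,3)] by (metis card_0_eq)
    then have "\<forall>z\<in>cball 0 R. G z \<noteq> 0" by blast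
    with 0 show ?case by (intro exI[of _ "\<lambda>_. 1"] exI[of _ G]) auto
  next
    case (Suc n)
    let ?Z = "{z \<in> cball 0 R. G z = 0}"
    from Suc(2) obtain a where a: "a \<in> ?Z" by (metis (no_types, lifting) card.empty ex_in_conv nat.distinct(1))
    have a0: "a \<noteq> 0" "cmod a \<le> R" "G a = 0" using a Suc.prems by auto
    obtain h m where h: "h holomorphic_on UNIV" "h a \<noteq> 0" "\<And>z. G z = (z - a) ^ m * h z"
      using entire_divide_zero[OF Suc.prems] by metis
    \<comment> \<open>The constant \<open>(- a) ^ m\<close> turns \<open>(z - a) ^ m\<close> into
      \<open>(1 - z / a) ^ m\<close>, which is \<open>1\<close> at \<open>0\<close>.\<close>
    define h' where "h' z = (- a) ^ m * h z" for z
    have Gh: "G z = (1 - z / a) ^ m * h' z" for z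
    proof -
      have "z - a = (1 - z / a) * (- a)" using a0 by (simp add: field_simps)
      then have "(z - a) ^ m = (1 - z / a) ^ m * (- a) ^ m" by (simp only: power_mult_distrib)
      then show ?thesis by (simp only: h(3) h'_def mult.assoc)
    qed
    have "m \<noteq> 0" using h(2) h(3)[of a] a0 by (cases m) auto
    have Zh: "{z \<in> cball 0 R. h' z = 0} = ?Z - {a}"
      using h \<open>m \<noteq> 0\<close> a0 by (auto simp: h'_def)
    have h'h: "h' holomorphic_on UNIV" unfolding h'_def by (intro holomorphic_intros h)
    moreover have "h' 0 \<noteq> 0" using Gh[of 0] Suc.prems by auto
    moreover have "n = card {z \<in> cball 0 R. h' z = 0}"
      unfolding Zh using Suc(2) a finite_zeros_cball[OF Suc.prems] by (metis card_Diff_singleton diff_Suc_1)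
    ultimately obtain P H where PH: "P holomorphic_on UNIV" "H holomorphic_on UNIV"
      "\<And>z. h' z = P z * H z" "P 0 = 1" "\<And>z. 2 * R \<le> cmod z \<Longrightarrow> 1 \<le> cmod (P z)"
      "\<And>z. z \<in> cball 0 R \<Longrightarrow> H z \<noteq> 0"
      using Suc(1)[of h'] by blast
    have "1 \<le> cmod ((1 - z / a) ^ m * P z)" if z: "2 * R \<le> cmod z" for z
    proof -
      have "2 * cmod a \<le> cmod z" using z a0 by simp
      then have "1 \<le> cmod (z / a) - cmod 1" using a0 by (simp add: norm_divide field_simps)
      also have "\<dots> \<le> cmod (1 - z / a)" by (metis norm_minus_commute norm_triangle_ineq2)
      finally have "1 \<le> cmod ((1 - z / a) ^ m)" by (simp add: norm_power one_le_power)
      then show ?thesis using PH(5)[OF z] unfolding norm_mult by (metis mult_mono' mult_1 zero_le_one)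
    qed
    moreover have "(\<lambda>z. (1 - z / a) ^ m * P z) holomorphic_on UNIV"
      using PH a0 by (intro holomorphic_intros) auto
    ultimately show ?case using PH
      by (intro exI[of _ "\<lambda>z. (1 - z / a) ^ m * P z"] exI[of _ H]) (auto simp: Gh)
qed

text \<open>Split \<open>G = P * H\<close> with \<open>H\<close> zero-free in a disc. As
  \<open>cmod P\<close> is at least \<open>1\<close> on the circle of radius \<open>2 * R\<close>,
  the maximum principle bounds \<open>H\<close> and \<open>exp \<alpha> * H\<close> inside.
  Borel-Caratheodory for a logarithm of \<open>H\<close> turns the upper bound on \<open>H\<close>
  into a lower one, and division bounds \<open>exp (\<alpha> z)\<close>.\<close>

lemma exp_type_exp_quotient0:
  assumes G: "G holomorphic_on UNIV" "G 0 \<noteq> 0" and \<alpha>: "\<alpha> holomorphic_on UNIV"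
    and et: "exp_type G" "exp_type (\<lambda>z. exp (\<alpha> z) * G z)"
  shows "exp_type (\<lambda>z. exp (\<alpha> z))"
proof -
  obtain C1 where C1: "0 \<le> C1" "\<And>z. cmod (G z) \<le> exp (C1 * (1 + cmod z))"
    using exp_typeE[OF et(1)] by metis
  obtain C2 where C2: "0 \<le> C2" "\<And>z. cmod (exp (\<alpha> z) * G z) \<le> exp (C2 * (1 + cmod z))"
    using exp_typeE[OF et(2)] by metis
  define C where "C = max C1 C2"
  have C: "0 \<le> C" using C1 by (simp add: C_def)
  have CG: "cmod (G z) \<le> exp (C * (1 + cmod z))" "cmod (exp (\<alpha> z) * G z) \<le> exp (C * (1 + cmod z))" for z
  proof -
    have "C1 * (1 + cmod z) \<le> C * (1 + cmod z)" "C2 * (1 + cmod z) \<le> C * (1 + cmod z)"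
      by (auto simp: C_def intro!: mult_right_mono)
    then have "exp (C1 * (1 + cmod z)) \<le> exp (C * (1 + cmod z))"
       "exp (C2 * (1 + cmod z)) \<le> exp (C * (1 + cmod z))" by (simp_all only: exp_le_cancel_iff)
    then show "cmod (G z) \<le> exp (C * (1 + cmod z))" "cmod (exp (\<alpha> z) * G z) \<le> exp (C * (1 + cmod z))"
      using C1(2)[of z] C2(2)[of z] by linarith+
  qed
  \<comment> \<open>\<open>P 0 = 1\<close> gives \<open>H 0 = G 0\<close>, so this value of
    \<open>Re (\<phi> 0)\<close> is the same for all discs.\<close>
  define l where "l = ln (cmod (G 0))"
  show ?thesis
  proof (rule exp_typeI)
    fix z :: complex
    \<comment> \<open>\<open>R\<close> is the radius required by \<open>borel_caratheodory\<close>;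
      \<open>L\<close> is the exponent of the growth bound on the circle of radius
      \<open>2 * R\<close>.\<close>
    define R where "R = 2 * cmod z + 1"
    define L where "L = C * (1 + 2 * R)"
    have R: "0 < R" by (simp add: R_def add_nonneg_pos)
    obtain P H where PH: "P holomorphic_on UNIV" "H holomorphic_on UNIV"
      "\<And>z. G z = P z * H z" "P 0 = 1" "\<And>z. 2 * R \<le> cmod z \<Longrightarrow> 1 \<le> cmod (P z)"
      "\<And>z. z \<in> cball 0 R \<Longrightarrow> H z \<noteq> 0"
      using entire_split_zeros[OF G R] by blast
    have bound: "cmod (U w) \<le> exp L"
      if U: "U holomorphic_on UNIV" "\<And>z. cmod (P z * U z) \<le> exp (C * (1 + cmod z))"
        and w: "w \<in> cball 0 (2 * R)" for U w
    proof (rule maximum_modulus_frontier[OF _ _ _ _ w])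
      show "U holomorphic_on interior (cball 0 (2 * R))" using U holomorphic_on_subset by blast
      show "continuous_on (closure (cball 0 (2 * R))) U"
        using U holomorphic_on_subset holomorphic_on_imp_continuous_on by blast
      fix u :: complex assume "u \<in> frontier (cball 0 (2 * R))"
      then have u: "cmod u = 2 * R" by simp
      have "1 * cmod (U u) \<le> cmod (P u) * cmod (U u)"
        using PH(5)[of u] u by (intro mult_right_mono) auto
      also have "\<dots> \<le> exp L" using U(2)[of u] u by (simp add: norm_mult L_def)
      finally show "cmod (U u) \<le> exp L" by simp
    qed auto
    have H: "cmod (H w) \<le> exp L" "cmod (exp (\<alpha> w) * H w) \<le> exp L" if "w \<in> cball 0 (2 * R)" for w
    proof -
      show "cmod (H w) \<le> exp L" by (rule bound[OF PH(2) _ that]) (metis CG(1) PH(3))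
      have "(\<lambda>z. exp (\<alpha> z) * H z) holomorphic_on UNIV" using PH(2) \<alpha> by (intro holomorphic_intros)
      then show "cmod (exp (\<alpha> w) * H w) \<le> exp L"
      proof (rule bound[OF _ _ that])
        fix z
        have "P z * (exp (\<alpha> z) * H z) = exp (\<alpha> z) * G z" by (simp add: PH(3))
        then show "cmod (P z * (exp (\<alpha> z) * H z)) \<le> exp (C * (1 + cmod z))" by (simp only: CG(2))
      qed
    qed
    have "H holomorphic_on ball 0 R" using PH(2) holomorphic_on_subset by blast
    moreover have "H z \<noteq> 0" if "z \<in> ball 0 R" for z using PH(6) that by simp
    ultimately obtain \<phi> where \<phi>: "\<phi> holomorphic_on ball 0 R" "\<And>z. z \<in> ball 0 R \<Longrightarrow> H z = exp (\<phi> z)"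
      using holomorphic_log_ball[of H 0 R] by blast
    have zR: "z \<in> ball 0 R" using norm_ge_zero[of z] by (simp add: R_def del: norm_ge_zero)
    have "cmod (\<phi> z - \<phi> 0) \<le> 2 * (L + 1 - Re (\<phi> 0))"
    proof (rule borel_caratheodory)
      show "\<phi> holomorphic_on ball 0 (2 * cmod z + 1)" using \<phi>(1) by (simp only: R_def)
      fix w :: complex assume "w \<in> ball 0 (2 * cmod z + 1)"
      then have w: "w \<in> ball 0 R" by (simp only: R_def)
      then have "cmod (H w) \<le> exp L" using R by (intro H) auto
      then show "Re (\<phi> w) \<le> L" using \<phi>(2)[OF w] by simp
    qed
    moreover have "Re (\<phi> 0) - Re (\<phi> z) \<le> cmod (\<phi> z - \<phi> 0)"
      using complex_Re_le_cmod[of "\<phi> 0 - \<phi> z"] by (simp add: norm_minus_commute)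
    moreover have "Re (\<phi> 0) = l"
      using \<phi>(2)[of 0] PH(3)[of 0] PH(4) R by (simp add: l_def)
    moreover have "Re (\<alpha> z) + Re (\<phi> z) \<le> L"
    proof -
      have "cmod (exp (\<alpha> z) * H z) \<le> exp L" using zR R by (intro H) auto
      then show ?thesis using \<phi>(2)[OF zR] by (simp add: norm_mult exp_add[symmetric])
    qed
    \<comment> \<open>Uses the lower bound
      \<open>Re (\<phi> z) \<ge> 3 * l - 2 * L - 2\<close>.\<close>
    ultimately have "Re (\<alpha> z) \<le> 3 * L + 2 - 3 * l"
      unfolding distrib_left right_diff_distrib by linarith
    also have "\<dots> = (9 * C + 2 - 3 * l) + 12 * C * cmod z"
      by (simp add: L_def R_def algebra_simps)
    finally have "exp (Re (\<alpha> z)) \<le> exp ((9 * C + 2 - 3 * l) + 12 * C * cmod z)"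
      by (rule iffD2[OF exp_le_cancel_iff])
    then show "cmod (exp (\<alpha> z)) \<le> exp ((9 * C + 2 - 3 * l) + 12 * C * cmod z)"
      by (simp only: norm_exp_eq_Re)
  qed (use C in simp)
qed

text \<open>Translation moves \<open>p\<close> to the origin, where the normalised products of
  \<open>entire_split_zeros\<close> are available.\<close>

lemma exp_type_exp_quotient:
  assumes G: "G holomorphic_on UNIV" "G p \<noteq> 0" and \<alpha>: "\<alpha> holomorphic_on UNIV"
    and et: "exp_type G" "exp_type (\<lambda>z. exp (\<alpha> z) * G z)"
  shows "exp_type (\<lambda>z. exp (\<alpha> z))"
proof -
  have sh: "(\<lambda>z. f (1 * z + p)) holomorphic_on UNIV" if "f holomorphic_on UNIV" for f
  proof -
    have "(\<lambda>z. 1 * z + p) holomorphic_on UNIV" by (intro holomorphic_intros)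
    from holomorphic_on_compose_gen[OF this that] show ?thesis by (simp add: o_def)
  qed
  have "exp_type (\<lambda>z. exp (\<alpha> (1 * z + p)))"
    by (rule exp_type_exp_quotient0[OF sh[OF G(1)] _ sh[OF \<alpha>] exp_type_affine[OF et(1)]
       exp_type_affine[OF et(2)]]) (use G in simp)
  from exp_type_affine[OF this, of 1 "- p"] show ?thesis by simp
qed

text \<open>Equal orders make the singularities of \<open>g / f\<close> removable with nonzero
  values, so the extension is entire and zero-free, hence an exponential.\<close>

lemma entire_same_zeros_exp_quotient:
  assumes f: "f holomorphic_on UNIV" "f p \<noteq> 0" and g: "g holomorphic_on UNIV" "g q \<noteq> 0"
    and zeros: "\<And>z. f z = 0 \<longleftrightarrow> g z = 0" and ord: "\<And>z. f z = 0 \<Longrightarrow> zorder f z = zorder g z"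
  obtains \<alpha> where "\<alpha> holomorphic_on UNIV" "\<And>z. g z = exp (\<alpha> z) * f z"
proof -
  \<comment> \<open>At a common zero the equal powers cancel, and the quotient of the cofactors is
    the limit of \<open>g / f\<close>.\<close>
  define Q where "Q z = (if f z = 0 then zor_poly g z z / zor_poly f z z else g z / f z)" for z
  have loc: "\<exists>r>0. Q holomorphic_on ball z r \<and> Q z \<noteq> 0" for z
  proof (cases "f z = 0")
    case True
    define n where "n = nat (zorder f z)"
    obtain r1 where r1: "r1 > 0"
      "zor_poly f z holomorphic_on cball z r1"
      "\<And>w. w \<in> cball z r1 \<Longrightarrow> f w = zor_poly f z w * (w - z) ^ n \<and> zor_poly f z w \<noteq> 0"
      using zorder_exist_zero_entire[OF f, of z] unfolding n_def by metis
    obtain r2 where r2: "r2 > 0"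
      "zor_poly g z holomorphic_on cball z r2"
      "\<And>w. w \<in> cball z r2 \<Longrightarrow> g w = zor_poly g z w * (w - z) ^ n \<and> zor_poly g z w \<noteq> 0"
      using zorder_exist_zero_entire[OF g, of z] unfolding n_def ord[OF True] by metis
    define r where "r = min r1 r2"
    have "(\<lambda>w. zor_poly g z w / zor_poly f z w) holomorphic_on ball z r"
      using r1 r2 holomorphic_on_subset[OF r1(2), of "ball z r"] holomorphic_on_subset[OF r2(2), of "ball z r"]
      by (intro holomorphic_intros) (auto simp: r_def)
    then have "Q holomorphic_on ball z r"
    proof (rule holomorphic_transform)
      fix w assume "w \<in> ball z r"
      then show "zor_poly g z w / zor_poly f z w = Q w"
        using r1(3)[of w] r2(3)[of w] True by (cases "w = z") (auto simp: r_def Q_def)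
    qed
    moreover have "Q z \<noteq> 0" using r1(3)[of z] r2(3)[of z] r1(1) r2(1) True by (simp add: Q_def)
    ultimately show ?thesis using r1 r2 by (intro exI[of _ r]) (auto simp: r_def)
  next
    case False
    have "open {w. f w \<noteq> 0}"
      using holomorphic_on_imp_continuous_on[OF f(1)] by (intro open_Collect_neq) auto
    then obtain r where r: "r > 0" "ball z r \<subseteq> {w. f w \<noteq> 0}"
      using False open_contains_ball by blast
    have "(\<lambda>w. g w / f w) holomorphic_on ball z r"
      using r holomorphic_on_subset[OF f(1)] holomorphic_on_subset[OF g(1)]
      by (intro holomorphic_intros) auto
    then have "Q holomorphic_on ball z r"
      by (rule holomorphic_transform) (use r in \<open>auto simp: Q_def\<close>)
    then show ?thesis using r False zeros[of z] by (intro exI[of _ r]) (auto simp: Q_def)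
  qed
  have "Q field_differentiable at z" for z
  proof -
    obtain r where "r > 0" "Q holomorphic_on ball z r" using loc by blast
    then show ?thesis using holomorphic_on_imp_differentiable_at[of Q "ball z r" z] by simp
  qed
  then have "Q holomorphic_on UNIV" by (simp add: holomorphic_on_def)
  then obtain \<alpha> where \<alpha>: "\<alpha> holomorphic_on UNIV" "\<And>z. Q z = exp (\<alpha> z)"
    using contractible_imp_holomorphic_log[of Q UNIV] loc by (metis UNIV_I contractible_UNIV)
  have "g z = exp (\<alpha> z) * f z" for z
    using zeros[of z] by (simp add: \<alpha>(2)[symmetric] Q_def)
  with \<alpha> show ?thesis using that by blast
qed

section \<open>Rescaling\<close>

text \<open>Pang's variant of Zalcman's rescaling: the scale is chosen so that \<open>F (z + \<rho> \<zeta>) / \<rho>\<close>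
  has spherical derivative exactly \<open>1\<close> at the origin.\<close>
lemma rescaling:
  assumes hol: "F holomorphic_on UNIV" and zero: "\<And>z. F z = 0 \<Longrightarrow> deriv F z = 0"
    and unbounded: "\<not> (\<exists>M. \<forall>z. cmod (deriv F z) \<le> M * (1 + (cmod (F z))\<^sup>2))"
    and "0 < N"
  obtains z0 \<rho> g where "0 < \<rho>" "\<rho> * N \<le> 1" "\<And>\<zeta>. g \<zeta> = F (z0 + of_real \<rho> * \<zeta>) / of_real \<rho>"
    "\<And>\<zeta>. deriv g \<zeta> = deriv F (z0 + of_real \<rho> * \<zeta>)" "g holomorphic_on UNIV"
    "cmod (deriv g 0) = 1 + (cmod (g 0))\<^sup>2"
    "\<And>\<zeta>. \<zeta> \<in> cball 0 N \<Longrightarrow> cmod (deriv g \<zeta>) \<le> 1 + 4 * (cmod (g \<zeta>))\<^sup>2"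
proof -
  \<comment> \<open>For \<open>\<rho> = 1 / k z0\<close> the rescaled function has at
    \<open>0\<close> modulus \<open>cmod (F z0) * k z0\<close> and derivative
    \<open>deriv F z0\<close>; \<open>k\<close> solves
    \<open>cmod (deriv F z) = 1 + (cmod (F z) * k z)\<^sup>2\<close> where
    \<open>cmod (deriv F z) > 1\<close> and is \<open>0\<close> elsewhere.\<close>
  define k where "k z = sqrt (max 0 (cmod (deriv F z) - 1)) / cmod (F z)" for z
  have contF: "continuous_on UNIV F" "continuous_on UNIV (deriv F)"
    using hol holomorphic_deriv[OF hol] holomorphic_on_imp_continuous_on by auto
  have k0: "0 \<le> k z" for z by (simp add: k_def)
  \<comment> \<open>At a zero of \<open>F\<close> also \<open>deriv F\<close> vanishes, so the
    numerator of \<open>k\<close> is \<open>0\<close> in a whole neighbourhood and the division by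
    zero does no harm.\<close>
  have "isCont k z" for z
  proof (cases "F z = 0")
    case True
    have "open {w. cmod (deriv F w) < 1}"
      using contF by (intro open_Collect_less continuous_on_norm continuous_on_const)
    moreover have "z \<in> {w. cmod (deriv F w) < 1}" using zero[OF True] by simp
    ultimately have "\<forall>\<^sub>F w in nhds z. w \<in> {w. cmod (deriv F w) < 1}"
      by (rule eventually_nhds_in_open)
    then have "\<forall>\<^sub>F w in nhds z. k w = 0"
      by eventually_elim (simp add: k_def)
    then show ?thesis using isCont_cong[of k "\<lambda>_. 0" z] by simp
  next
    case False
    have "isCont F z" "isCont (deriv F) z"
      using contF by (auto simp: continuous_on_eq_continuous_at)
    then show ?thesis unfolding k_def using False by (intro continuous_intros) auto
  qed
  then have contk: "continuous_on S k" for S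
    by (simp add: continuous_at_imp_continuous_on)
  \<comment> \<open>The constant \<open>1 + (2 * N)\<^sup>2\<close> is chosen to produce a point
    with \<open>k w > 2 * N\<close>.\<close>
  obtain w where w: "(1 + (2 * N)\<^sup>2) * (1 + (cmod (F w))\<^sup>2) < cmod (deriv F w)"
    using unbounded by (meson not_le)
  then have w': "1 + (2 * N)\<^sup>2 * (cmod (F w))\<^sup>2 < cmod (deriv F w)"
  proof -
    have "(1 + (2 * N)\<^sup>2) * (1 + (cmod (F w))\<^sup>2)
        = 1 + (2 * N)\<^sup>2 * (cmod (F w))\<^sup>2 + ((2 * N)\<^sup>2 + (cmod (F w))\<^sup>2)"
      by algebra
    moreover have "0 \<le> (2 * N)\<^sup>2 + (cmod (F w))\<^sup>2" by simp
    ultimately show ?thesis using w by linarith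
  qed
  have "2 * N < k w"
  proof -
    have "0 \<le> (2 * N)\<^sup>2 * (cmod (F w))\<^sup>2" by simp
    then have "0 < cmod (deriv F w)" using w' by linarith
    then have Fw: "0 < cmod (F w)" using zero by force
    have "(2 * N * cmod (F w))\<^sup>2 < cmod (deriv F w) - 1" using w' by (simp add: power_mult_distrib)
    then have "2 * N * cmod (F w) < sqrt (max 0 (cmod (deriv F w) - 1))"
      by (intro real_less_rsqrt) auto
    then show ?thesis using Fw by (simp add: k_def pos_less_divide_eq)
  qed
  \<comment> \<open>Zalcman's device: the weight \<open>1 - dist w z\<close> vanishes on the
    boundary, so the maximiser lies inside and \<open>k\<close> cannot be much larger near
    it.\<close>
  have "\<exists>z0\<in>cball w 1. \<forall>z\<in>cball w 1. (1 - dist w z) * k z \<le> (1 - dist w z0) * k z0"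
    by (intro continuous_attains_sup continuous_intros contk) auto
  then obtain z0 where z0: "z0 \<in> cball w 1"
    "\<And>z. z \<in> cball w 1 \<Longrightarrow> (1 - dist w z) * k z \<le> (1 - dist w z0) * k z0" by blast
  define \<delta> where "\<delta> = 1 - dist w z0"
  have "2 * N < \<delta> * k z0" using z0(2)[of w] \<open>2 * N < k w\<close> by (simp add: \<delta>_def)
  have "0 \<le> \<delta>" "\<delta> \<le> 1" using z0 by (auto simp: \<delta>_def)
  have kz0: "2 * N < k z0"
    using \<open>2 * N < \<delta> * k z0\<close> mult_right_mono[OF \<open>\<delta> \<le> 1\<close> k0[of z0]] by simp
  then have kpos: "0 < k z0" using \<open>0 < N\<close> by simp
  define \<rho> where "\<rho> = 1 / k z0"
  have \<rho>: "0 < \<rho>" "\<rho> * N \<le> 1" using kpos kz0 \<open>0 < N\<close> by (auto simp: \<rho>_def)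
  define g where "g \<zeta> = F (z0 + of_real \<rho> * \<zeta>) / of_real \<rho>" for \<zeta>
  have dg: "(g has_field_derivative deriv F (z0 + of_real \<rho> * \<zeta>)) (at \<zeta>)" for \<zeta>
  proof -
    have "(F has_field_derivative deriv F (z0 + of_real \<rho> * \<zeta>)) (at (z0 + of_real \<rho> * \<zeta>))"
      using hol holomorphic_derivI by blast
    moreover have "((\<lambda>\<zeta>. z0 + of_real \<rho> * \<zeta>) has_field_derivative of_real \<rho>) (at \<zeta>)"
      by (auto intro!: derivative_eq_intros)
    ultimately have "((\<lambda>\<zeta>. F (z0 + of_real \<rho> * \<zeta>)) has_field_derivative
        deriv F (z0 + of_real \<rho> * \<zeta>) * of_real \<rho>) (at \<zeta>)"
      by (rule DERIV_chain2)
    from DERIV_cdivide[OF this, of "of_real \<rho>"] show ?thesis using \<rho> unfolding g_def by simp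
  qed
  have dg': "deriv g \<zeta> = deriv F (z0 + of_real \<rho> * \<zeta>)" for \<zeta>
    using dg by (rule DERIV_imp_deriv)
  have "g holomorphic_on UNIV"
    using dg by (auto simp: holomorphic_on_def field_differentiable_def)
  have gk: "cmod (g \<zeta>) = cmod (F (z0 + of_real \<rho> * \<zeta>)) * k z0" for \<zeta>
    using kpos by (simp add: g_def \<rho>_def norm_divide norm_mult)
  have "cmod (deriv g 0) = 1 + (cmod (g 0))\<^sup>2"
  proof -
    have "F z0 \<noteq> 0" using kpos by (auto simp: k_def)
    then have "k z0 * cmod (F z0) = sqrt (max 0 (cmod (deriv F z0) - 1))" by (simp add: k_def)
    moreover from this have "max 0 (cmod (deriv F z0) - 1) > 0"
      using kpos \<open>F z0 \<noteq> 0\<close> by (smt (verit) mult_pos_pos real_sqrt_gt_0_iff zero_less_norm_iff)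
    ultimately have "(k z0 * cmod (F z0))\<^sup>2 = cmod (deriv F z0) - 1" by simp
    then show ?thesis by (simp add: dg' gk mult.commute)
  qed
  moreover have "cmod (deriv g \<zeta>) \<le> 1 + 4 * (cmod (g \<zeta>))\<^sup>2" if "\<zeta> \<in> cball 0 N" for \<zeta>
  proof (cases "cmod (deriv F (z0 + of_real \<rho> * \<zeta>)) \<le> 1")
    case True
    then show ?thesis by (smt (verit) dg' zero_le_power2)
  next
    case False
    \<comment> \<open>\<open>z\<close> is within \<open>\<delta> / 2\<close> of \<open>z0\<close>,
      where the weight is at least \<open>\<delta> / 2\<close>; hence
      \<open>k z \<le> 2 * k z0\<close>, and squaring this \<open>2\<close> gives the
      \<open>4\<close> of the claim.\<close>
    define z where "z = z0 + of_real \<rho> * \<zeta>"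
    have "dist z0 z = \<rho> * cmod \<zeta>" using \<rho> by (simp add: z_def dist_norm norm_mult)
    also have "\<dots> \<le> \<rho> * N" using that \<rho> by (intro mult_left_mono) auto
    also have "\<dots> \<le> \<delta> / 2" using \<open>2 * N < \<delta> * k z0\<close> kpos by (simp add: \<rho>_def field_simps)
    finally have dz: "\<delta> / 2 \<le> 1 - dist w z"
      using dist_triangle[of w z z0] by (simp add: \<delta>_def)
    then have "z \<in> cball w 1" using \<open>0 \<le> \<delta>\<close> by simp
    have "\<delta> / 2 * k z \<le> (1 - dist w z) * k z" using dz k0 by (intro mult_right_mono) auto
    also have "\<dots> \<le> \<delta> * k z0" using z0(2)[OF \<open>z \<in> cball w 1\<close>] by (simp add: \<delta>_def)
    finally have "\<delta> * k z \<le> \<delta> * (2 * k z0)" by simp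
    moreover have "0 < \<delta>" using \<open>2 * N < \<delta> * k z0\<close> \<open>0 \<le> \<delta>\<close> \<open>0 < N\<close> by (cases "\<delta> = 0") auto
    ultimately have kz: "k z \<le> 2 * k z0" by simp
    have "F z \<noteq> 0" using False zero by (force simp: z_def)
    then have "sqrt (cmod (deriv F z) - 1) = k z * cmod (F z)"
      using False by (simp add: k_def z_def)
    also have "\<dots> \<le> 2 * k z0 * cmod (F z)" using kz by (intro mult_right_mono) auto
    also have "\<dots> = 2 * cmod (g \<zeta>)" by (simp add: gk z_def)
    finally have "cmod (deriv F z) - 1 \<le> (2 * cmod (g \<zeta>))\<^sup>2"
      using sqrt_le_D by blast
    then show ?thesis by (simp add: dg' z_def power_mult_distrib)
  qed
  ultimately show ?thesis using that \<rho> g_def dg' \<open>g holomorphic_on UNIV\<close> by blast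
qed

section \<open>A priori bounds for the rescaled functions\<close>

lemma deriv_le_log_modulus:
  assumes hol: "g holomorphic_on ball z0 d" and "0 < d"
    and gt: "\<And>z. z \<in> ball z0 d \<Longrightarrow> 1 < cmod (g z)"
  shows "d * cmod (deriv g z0) \<le> 2 * cmod (g z0) * ln (cmod (g z0))"
proof -
  have "g z \<noteq> 0" if "z \<in> ball z0 d" for z using gt[OF that] by force
  then obtain \<phi> where \<phi>: "\<phi> holomorphic_on ball z0 d" "\<And>z. z \<in> ball z0 d \<Longrightarrow> g z = exp (\<phi> z)"
    using holomorphic_log_ball[OF hol] by blast
  have z0: "z0 \<in> ball z0 d" using \<open>0 < d\<close> by simp
  have ln: "Re (\<phi> z) = ln (cmod (g z))" if "z \<in> ball z0 d" for z using \<phi>(2)[OF that] by simp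
  have "(\<phi> has_field_derivative deriv \<phi> z0) (at z0)"
    using \<phi> z0 holomorphic_derivI by blast
  then have "((\<lambda>z. exp (\<phi> z)) has_field_derivative exp (\<phi> z0) * deriv \<phi> z0) (at z0)"
    by (auto intro!: derivative_eq_intros)
  then have "(g has_field_derivative g z0 * deriv \<phi> z0) (at z0)"
    unfolding \<phi>(2)[OF z0] using z0 \<phi>(2)
    by (elim has_field_derivative_transform_within_open[of _ _ _ "ball z0 d"]) auto
  then have "deriv g z0 = g z0 * deriv \<phi> z0" by (rule DERIV_imp_deriv)
  moreover have "d * cmod (deriv \<phi> z0) \<le> 2 * ln (cmod (g z0))"
  proof -
    have "0 < Re (\<phi> z)" if "z \<in> ball z0 d" for z unfolding ln[OF that] using gt[OF that] by (rule ln_gt_zero)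
    from deriv_half_plane[OF \<phi>(1) \<open>0 < d\<close> this] show ?thesis by (simp add: ln[OF z0])
  qed
  ultimately show ?thesis
    using mult_left_mono[of "d * cmod (deriv \<phi> z0)" "2 * ln (cmod (g z0))" "cmod (g z0)"]
    by (simp add: norm_mult algebra_simps)
qed

text \<open>If \<open>B = cmod (g 0)\<close> is large, so is \<open>deriv g 0\<close>, and a disc of
  radius \<open>d\<close> in \<open>{cmod g > 1}\<close> gives \<open>d * B \<le> 2 * ln B\<close>.
  A point at distance \<open>d\<close> with \<open>cmod (g w) \<le> 1\<close> gives
  \<open>ln B \<le> 20 * d\<close>. Together \<open>B \<le> 40\<close>.\<close>

lemma rescaled_center_bound:
  assumes hol: "g holomorphic_on UNIV" and "1 < N"
    and g0: "cmod (deriv g 0) = 1 + (cmod (g 0))\<^sup>2"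
    and g': "\<And>\<zeta>. \<zeta> \<in> cball 0 N \<Longrightarrow> cmod (deriv g \<zeta>) \<le> 1 + 4 * (cmod (g \<zeta>))\<^sup>2"
  shows "cmod (g 0) \<le> 40"
proof (rule ccontr)
  define B where "B = cmod (g 0)"
  assume "\<not> cmod (g 0) \<le> 40"
  then have B: "40 < B" by (simp add: B_def)
  have gr: "d * B \<le> 2 * ln B" if "0 < d" "\<And>z. z \<in> ball 0 d \<Longrightarrow> 1 < cmod (g z)" for d
  proof -
    have "d * cmod (deriv g 0) \<le> 2 * cmod (g 0) * ln (cmod (g 0))"
      by (rule deriv_le_log_modulus) (use that hol holomorphic_on_subset in auto)
    then have "d * (1 + B\<^sup>2) \<le> 2 * B * ln B" by (simp add: g0 B_def)
    then have "B * (d * B) \<le> B * (2 * ln B)" using that by (simp add: power2_eq_square algebra_simps)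
    then show ?thesis using B by simp
  qed
  define K where "K = {z \<in> cball 0 1. cmod (g z) \<le> 1}"
  show False
  proof (cases "K = {}")
    case True
    have "1 < cmod (g z)" if "z \<in> ball 0 1" for z
    proof (rule ccontr)
      assume "\<not> 1 < cmod (g z)"
      then have "z \<in> K" using that by (simp add: K_def)
      then show False using True by simp
    qed
    then have "B \<le> 2 * ln B" using gr[of 1] by simp
    \<comment> \<open>With \<open>ln 4 \<le> 3\<close> this turns \<open>B \<le> 2 * ln B\<close>
      into \<open>B \<le> 8\<close>.\<close>
    moreover have "ln (B / 4) \<le> B / 4 - 1" using B by (intro ln_le_minus_one) auto
    moreover have "ln (B / 4) = ln B - ln 4" using B by (simp add: ln_div)
    moreover have "ln 4 \<le> (3::real)" using ln_le_minus_one[of "4::real"] by simp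
    ultimately show False using B by simp
  next
    case False
    have "continuous_on (cball 0 1) (\<lambda>z. cmod (g z))"
      using hol holomorphic_on_imp_continuous_on continuous_on_subset
      by (intro continuous_on_norm) blast
    then have "closed K" unfolding K_def
      by (intro continuous_on_closed_Collect_le continuous_on_const closed_cball)
    then obtain w where w: "w \<in> K" "\<And>z. z \<in> K \<Longrightarrow> dist 0 w \<le> dist 0 z"
      using distance_attains_inf[of K 0] False by blast
    define d where "d = dist 0 w"
    have d: "0 < d" "d \<le> 1" using w B by (auto simp: d_def K_def B_def)
    have "1 < cmod (g z)" if "z \<in> ball 0 d" for z
    proof (rule ccontr)
      assume "\<not> 1 < cmod (g z)"
      then have "z \<in> K" using that d by (simp add: K_def)
      then show False using w(2)[of z] that by (simp add: d_def)
    qed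
    with d have 1: "d * B \<le> 2 * ln B" by (intro gr)
    have "cmod (g 0) \<le> 1 * exp (4 * 5 * dist 0 w / 1)"
    proof (rule modulus_le_exp_dist)
      show "g holomorphic_on ball 0 N" using hol holomorphic_on_subset by blast
      show "cball 0 (dist 0 w) \<subseteq> ball 0 N" using d \<open>1 < N\<close> by (auto simp: d_def)
      show "cmod (g w) \<le> 1" using w by (simp add: K_def)
      show "cmod (deriv g z) \<le> 5" if "z \<in> ball 0 N" "cmod (g z) = 1" for z
        using g'[of z] that by simp
    qed auto
    then have "B \<le> exp (20 * d)" by (simp add: B_def d_def)
    then have "ln B \<le> 20 * d" using B by (metis ln_exp ln_le_cancel_iff exp_gt_zero less_trans zero_less_numeral)
    with 1 have "d * B \<le> d * 40" by simp
    then show False using B d by simp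
  qed
qed

text \<open>\<open>modulus_le_exp_dist\<close> is started at the origin with \<open>A = 40\<close>:
  on that level the derivative is at most \<open>1 + 4 * 40\<^sup>2 = 6401\<close>, and
  \<open>4 * 6401 / 40 \<le> 641\<close>. The condition \<open>2 * cmod z < N\<close> keeps the
  auxiliary disc inside \<open>ball 0 N\<close>.\<close>

lemma rescaled_growth:
  assumes hol: "g holomorphic_on UNIV" and "1 < N"
    and g0: "cmod (deriv g 0) = 1 + (cmod (g 0))\<^sup>2"
    and g': "\<And>\<zeta>. \<zeta> \<in> cball 0 N \<Longrightarrow> cmod (deriv g \<zeta>) \<le> 1 + 4 * (cmod (g \<zeta>))\<^sup>2"
    and z: "2 * cmod z < N"
  shows "cmod (g z) \<le> exp (40 + 641 * cmod z)"
proof -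
  have "cmod (g z) \<le> 40 * exp (4 * 6401 * dist z 0 / 40)"
  proof (rule modulus_le_exp_dist)
    show "g holomorphic_on ball 0 N" using hol holomorphic_on_subset by blast
    show "cball z (dist z 0) \<subseteq> ball 0 N"
    proof
      fix u assume "u \<in> cball z (dist z 0)"
      then show "u \<in> ball 0 N" using z norm_triangle_ineq2[of u z] by (simp add: dist_norm norm_minus_commute)
    qed
    show "cmod (g 0) \<le> 40" using rescaled_center_bound assms by blast
    show "cmod (deriv g u) \<le> 6401" if "u \<in> ball 0 N" "cmod (g u) = 40" for u
      using g'[of u] that by simp
  qed auto
  also have "\<dots> \<le> exp 40 * exp (641 * cmod z)"
    using exp_ge_add_one_self[of "40::real"] by (intro mult_mono) auto
  finally show ?thesis by (simp add: exp_add)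
qed

section \<open>Normal limits and Hurwitz arguments\<close>

lemma uniform_limit_shift:
  assumes "uniform_limit K f l sequentially"
  shows "uniform_limit K (\<lambda>n. f (n + m)) l sequentially"
  using filterlim_compose[OF assms filterlim_add_const_nat_at_top[of m]] by simp

text \<open>Montel's theorem asks for a bound on the whole family; the first \<open>n0\<close>
  members are bounded on \<open>K\<close> by continuity.\<close>

lemma bounded_family_if_eventually_bounded:
  fixes f :: "nat \<Rightarrow> complex \<Rightarrow> complex"
  assumes cont: "\<And>n. continuous_on UNIV (f n)" and "compact K"
    and ev: "\<And>n z. n0 \<le> n \<Longrightarrow> z \<in> K \<Longrightarrow> cmod (f n z) \<le> B"
  shows "\<exists>B. \<forall>h\<in>range f. \<forall>z\<in>K. cmod (h z) \<le> B"
proof -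
  have "bounded (f n ` K)" for n
    using continuous_on_subset[OF cont] \<open>compact K\<close> compact_continuous_image compact_imp_bounded by blast
  then have "bounded ((\<Union>n<n0. f n ` K) \<union> cball 0 B)"
    by (intro iffD2[OF bounded_Un] conjI bounded_UN) auto
  then obtain C where C: "\<And>x. x \<in> (\<Union>n<n0. f n ` K) \<union> cball 0 B \<Longrightarrow> cmod x \<le> C"
    unfolding bounded_iff by blast
  have "cmod (f n z) \<le> C" if "z \<in> K" for n z
  proof (rule C)
    show "f n z \<in> (\<Union>n<n0. f n ` K) \<union> cball 0 B"
      using ev[of n z] that by (cases "n < n0") auto
  qed
  then show ?thesis by blast
qed

lemma montel_entire:
  assumes hol: "\<And>n. f n holomorphic_on UNIV"
    and bound: "\<And>K. compact K \<Longrightarrow> \<exists>B. \<forall>h\<in>range f. \<forall>z\<in>K. cmod (h z) \<le> B"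
  shows "\<exists>l r. l holomorphic_on UNIV \<and> strict_mono (r :: nat \<Rightarrow> nat) \<and>
    (\<forall>K. compact K \<longrightarrow> uniform_limit K (\<lambda>n. f (r n)) l sequentially)"
proof (rule Montel[of UNIV "range f" f])
  fix l and r :: "nat \<Rightarrow> nat"
  assume "l holomorphic_on UNIV" "strict_mono r"
    "\<And>K. compact K \<Longrightarrow> K \<subseteq> UNIV \<Longrightarrow> uniform_limit K (f \<circ> r) l sequentially"
  then show ?thesis by (auto simp: o_def)
qed (use assms in auto)

text \<open>Montel is applied to the functions and then to their derivatives along the subsequence;
  Weierstrass' theorem identifies the second limit as \<open>deriv l\<close>.\<close>

lemma normal_limit_with_deriv:
  fixes g :: "nat \<Rightarrow> complex \<Rightarrow> complex"
  assumes hol: "\<And>n. g n holomorphic_on UNIV"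
    and bound: "\<And>R. \<exists>B n0. \<forall>n\<ge>n0. \<forall>z\<in>cball 0 R. cmod (g n z) \<le> B"
    and bound': "\<And>R. \<exists>B n0. \<forall>n\<ge>n0. \<forall>z\<in>cball 0 R. cmod (deriv (g n) z) \<le> B"
  obtains r l where "strict_mono (r :: nat \<Rightarrow> nat)" "l holomorphic_on UNIV"
    "\<And>K. compact K \<Longrightarrow> uniform_limit K (\<lambda>n. g (r n)) l sequentially"
    "\<And>K. compact K \<Longrightarrow> uniform_limit K (\<lambda>n. deriv (g (r n))) (deriv l) sequentially"
proof -
  have sub: "\<exists>R. K \<subseteq> cball 0 R" if K: "compact K" for K :: "complex set"
  proof -
    obtain R where "\<forall>z\<in>K. cmod z \<le> R" using compact_imp_bounded[OF K] unfolding bounded_iff by blast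
    then have "K \<subseteq> cball 0 R" by auto
    then show ?thesis by blast
  qed
  have B1: "\<exists>B. \<forall>h\<in>range g. \<forall>z\<in>K. cmod (h z) \<le> B" if K: "compact K" for K
  proof -
    obtain R where "K \<subseteq> cball 0 R" using sub K by blast
    moreover obtain B n0 where "\<forall>n\<ge>n0. \<forall>z\<in>cball 0 R. cmod (g n z) \<le> B" using bound by blast
    ultimately show ?thesis
      using hol holomorphic_on_imp_continuous_on K
      by (intro bounded_family_if_eventually_bounded[of g K n0 B]) auto
  qed
  obtain l r1 where l: "l holomorphic_on UNIV" "strict_mono (r1 :: nat \<Rightarrow> nat)"
    "\<And>K. compact K \<Longrightarrow> uniform_limit K (\<lambda>n. g (r1 n)) l sequentially"
    using montel_entire[OF hol B1] by blast
  define g1 where "g1 n = deriv (g (r1 n))" for n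
  have hol1: "g1 n holomorphic_on UNIV" for n
    unfolding g1_def using hol by (intro holomorphic_deriv) auto
  have B2: "\<exists>B. \<forall>h\<in>range g1. \<forall>z\<in>K. cmod (h z) \<le> B" if K: "compact K" for K
  proof -
    obtain R where "K \<subseteq> cball 0 R" using sub K by blast
    moreover obtain B n0 where B: "\<And>n z. n \<ge> n0 \<Longrightarrow> z\<in>cball 0 R \<Longrightarrow> cmod (deriv (g n) z) \<le> B"
      using bound' by blast
    moreover have "n \<le> r1 n" for n using l(2) by (rule seq_suble)
    ultimately have "cmod (g1 n z) \<le> B" if "n0 \<le> n" "z \<in> K" for n z
      unfolding g1_def using that by (meson le_trans subsetD)
    then show ?thesis
      using hol1 holomorphic_on_imp_continuous_on K
      by (intro bounded_family_if_eventually_bounded[of g1 K n0 B]) auto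
  qed
  obtain h r2 where h: "h holomorphic_on UNIV" "strict_mono (r2 :: nat \<Rightarrow> nat)"
    "\<And>K. compact K \<Longrightarrow> uniform_limit K (\<lambda>n. g1 (r2 n)) h sequentially"
    using montel_entire[OF hol1 B2] by blast
  define r where "r = r1 \<circ> r2"
  have r: "strict_mono r" unfolding r_def using l h by (intro strict_mono_o)
  have 1: "uniform_limit K (\<lambda>n. g (r n)) l sequentially" if "compact K" for K
    using filterlim_compose[OF l(3)[OF that] filterlim_subseq[OF h(2)]] by (simp add: r_def o_def)
  have "deriv l = h"
  proof
    fix z
    have "uniform_limit (ball z 1) (\<lambda>n. g (r n)) l sequentially"
      by (rule uniform_limit_on_subset[OF 1[OF compact_cball] ball_subset_cball])
    then have "(\<lambda>n. deriv (g (r n)) z) \<longlonglongrightarrow> deriv l z"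
      by (rule deriv_complex_uniform_limit)
         (auto intro!: always_eventually holomorphic_on_subset[OF hol])
    moreover have "(\<lambda>n. deriv (g (r n)) z) \<longlonglongrightarrow> h z"
      using tendsto_uniform_limitI[OF h(3), of "{z}" z] by (simp add: g1_def r_def)
    ultimately show "deriv l z = h z" by (rule LIMSEQ_unique)
  qed
  then have 2: "uniform_limit K (\<lambda>n. deriv (g (r n))) (deriv l) sequentially" if "compact K" for K
    using h(3)[OF that] by (simp add: g1_def r_def o_def)
  show ?thesis using that[OF r l(1) 1 2] .
qed

text \<open>If \<open>deriv l p\<close> were nonzero, then for large \<open>n\<close> the
  derivatives of \<open>g n\<close> would have no zeros near \<open>p\<close>, hence by
  \<open>crit\<close> neither would \<open>g n\<close>, and Hurwitz would forbid
  \<open>l p = 0\<close>.\<close>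

lemma limit_zeros_critical:
  fixes g :: "nat \<Rightarrow> complex \<Rightarrow> complex"
  assumes hol: "\<And>n. g n holomorphic_on UNIV" "l holomorphic_on UNIV"
    and lim: "\<And>K. compact K \<Longrightarrow> uniform_limit K g l sequentially"
    and lim': "\<And>K. compact K \<Longrightarrow> uniform_limit K (\<lambda>n. deriv (g n)) (deriv l) sequentially"
    and crit: "\<And>n z. g n z = 0 \<Longrightarrow> deriv (g n) z = 0"
    and p: "l p = 0"
  shows "deriv l p = 0"
proof (rule ccontr)
  assume nz: "deriv l p \<noteq> 0"
  define c where "c = cmod (deriv l p) / 2"
  have c: "0 < c" "c < cmod (deriv l p)" using nz by (auto simp: c_def)
  have "continuous_on UNIV (deriv l)"
    using holomorphic_deriv[OF hol(2)] holomorphic_on_imp_continuous_on by auto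
  then have "open {z. c < cmod (deriv l z)}"
    by (intro open_Collect_less continuous_on_norm continuous_on_const)
  then obtain e where e: "e > 0" "cball p e \<subseteq> {z. c < cmod (deriv l z)}"
    using c open_contains_cball by blast
  from lim'[OF compact_cball[of p e]] c have "\<forall>\<^sub>F n in sequentially. \<forall>z\<in>cball p e. dist (deriv (g n) z) (deriv l z) < c"
    by (simp add: uniform_limit_iff)
  then obtain m where m: "\<And>n z. n \<ge> m \<Longrightarrow> z \<in> cball p e \<Longrightarrow> dist (deriv (g n) z) (deriv l z) < c"
    unfolding eventually_sequentially by blast
  have gnz: "g (n + m) z \<noteq> 0" if z: "z \<in> ball p e" for n z
  proof
    assume "g (n + m) z = 0"
    then have "deriv (g (n + m)) z = 0" by (rule crit)
    moreover have "z \<in> cball p e" using z by simp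
    ultimately have "cmod (deriv l z) < c" using m[of "n + m" z] by (simp add: dist_norm)
    then show False using e \<open>z \<in> cball p e\<close> by force
  qed
  have "l p \<noteq> 0"
  proof (rule Hurwitz_no_zeros[of "ball p e" "\<lambda>n. g (n + m)" l])
    show "uniform_limit K (\<lambda>n. g (n + m)) l sequentially" if "compact K" for K
      by (rule uniform_limit_shift) (rule lim[OF that])
    show "\<not> l constant_on ball p e"
    proof
      assume "l constant_on ball p e"
      then obtain k where k: "\<And>z. z \<in> ball p e \<Longrightarrow> l z = k" by (auto simp: constant_on_def)
      have "((\<lambda>_. k) has_field_derivative 0) (at p)" by simp
      then have "(l has_field_derivative 0) (at p)"
        using k e by (elim has_field_derivative_transform_within_open[of _ _ _ "ball p e"]) auto
      then show False using nz DERIV_imp_deriv by blast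
    qed
    show "g (n + m) holomorphic_on ball p e" "l holomorphic_on ball p e" for n
      using hol holomorphic_on_subset by blast+
  qed (use gnz e in auto)
  then show False using p by simp
qed

text \<open>By Hurwitz the limit omits \<open>c\<close> on a disc or is constant there; the disc is
  taken to contain both \<open>p\<close> and \<open>z\<close>.\<close>

lemma limit_attains_omitted_value:
  fixes h :: "nat \<Rightarrow> complex \<Rightarrow> complex"
  assumes hol: "\<And>n. h n holomorphic_on UNIV" "l holomorphic_on UNIV"
    and lim: "\<And>K. compact K \<Longrightarrow> uniform_limit K h l sequentially"
    and omit: "\<And>R. \<exists>m. \<forall>n\<ge>m. \<forall>z\<in>ball 0 R. h n z \<noteq> c"
    and p: "l p = c"
  shows "l z = c"
proof -
  define R where "R = max (cmod z) (cmod p) + 1"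
  have R: "z \<in> ball 0 R" "p \<in> ball 0 R" by (auto simp: R_def)
  obtain m where m: "\<And>n z. n \<ge> m \<Longrightarrow> z \<in> ball 0 R \<Longrightarrow> h n z \<noteq> c" using omit by blast
  have "(\<lambda>z. l z - c) constant_on ball 0 R"
  proof (rule ccontr)
    assume nc: "\<not> (\<lambda>z. l z - c) constant_on ball 0 R"
    have "l p - c \<noteq> 0"
    proof (rule Hurwitz_no_zeros[of "ball 0 R" "\<lambda>n z. h (n + m) z - c" "\<lambda>z. l z - c"])
      show "(\<lambda>z. h (n + m) z - c) holomorphic_on ball 0 R" for n
        using holomorphic_on_subset[OF hol(1)] by (intro holomorphic_intros) auto
      show "(\<lambda>z. l z - c) holomorphic_on ball 0 R"
        using holomorphic_on_subset[OF hol(2)] by (intro holomorphic_intros) auto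
      show "uniform_limit K (\<lambda>n z. h (n + m) z - c) (\<lambda>z. l z - c) sequentially" if "compact K" for K
        by (intro uniform_limit_intros uniform_limit_shift lim that)
      show "h (n + m) z - c \<noteq> 0" if "z \<in> ball 0 R" for n z using m that by simp
    qed (use nc R in auto)
    then show False using p by simp
  qed
  then show ?thesis using R p unfolding constant_on_def by (metis eq_iff_diff_eq_0)
qed

text \<open>Omission of \<open>1\<close> gives \<open>deriv g z = 1 + exp (a * z + b)\<close>. For
  \<open>a = 0\<close>, \<open>g\<close> is affine with a simple zero. Otherwise \<open>g\<close>
  has at most one zero, so it is \<open>(z - z0) ^ m\<close> times the exponential of an affine
  function; its values along a period of \<open>exp (a * z + b)\<close> contradict this unless
  \<open>m = 1\<close>, and then the zero is simple.\<close>

lemma no_exp_type_derivative_omitting_one: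
  assumes hol: "g holomorphic_on UNIV" and et: "exp_type g"
    and crit: "\<And>z. g z = 0 \<Longrightarrow> deriv g z = 0" and omit: "\<And>z. deriv g z \<noteq> 1"
    and nz: "deriv g q \<noteq> 0"
  shows False
proof -
  have dg: "(g has_field_derivative deriv g z) (at z)" for z
    using hol holomorphic_derivI by blast
  have hol1: "(\<lambda>z. deriv g z - 1) holomorphic_on UNIV"
    by (intro holomorphic_intros holomorphic_deriv hol) auto
  then obtain \<beta> where \<beta>: "\<beta> holomorphic_on UNIV" "\<And>z. deriv g z - 1 = exp (\<beta> z)"
    using contractible_imp_holomorphic_log[OF hol1 contractible_UNIV] omit by auto
  have "exp_type (\<lambda>z. exp (\<beta> z))"
    unfolding \<beta>(2)[symmetric] by (intro exp_type_diff exp_type_deriv exp_type_const et hol)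
  then obtain a b where ab: "\<And>z. \<beta> z = a * z + b"
    using affine_of_exp_type_exp[OF \<beta>(1)] by metis
  have g': "deriv g z = 1 + exp (a * z + b)" for z
    using \<beta>(2)[of z] by (simp add: ab algebra_simps)
  show False
  proof (cases "a = 0")
    case True
    define k where "k = 1 + exp b"
    have k: "k \<noteq> 0" using nz by (simp add: g' True k_def)
    have "((\<lambda>z. g z - k * z) has_field_derivative 0) (at z)" for z
      by (auto intro!: derivative_eq_intros dg simp: g' True k_def)
    from deriv_zero_imp_eq[OF this] have "g z - k * z = g 0 - k * 0" for z by blast
    from this[of "- g 0 / k"] have "g (- g 0 / k) = 0" using k by simp
    then show False using crit g' True k by (simp add: k_def)
  next
    case False
    have "((\<lambda>z. g z - z - exp (a * z + b) / a) has_field_derivative 0) (at z)" for z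
      using False by (auto intro!: derivative_eq_intros dg simp: g')
    from deriv_zero_imp_eq[OF this] have c': "g z - z - exp (a * z + b) / a = g 0 - 0 - exp (a * 0 + b) / a" for z
      by blast
    define c where "c = g 0 - exp b / a"
    have c: "g z = z + exp (a * z + b) / a + c" for z
      using c'[of z] by (simp add: c_def algebra_simps)
    define z0 where "z0 = 1 / a - c"
    \<comment> \<open>At a critical zero the exponential is \<open>-1\<close>, and
      \<open>g z = 0\<close> becomes a linear equation for \<open>z\<close>.\<close>
    have zeros: "z = z0" if "g z = 0" for z
    proof -
      have "exp (a * z + b) = -1" using crit[OF that] g'[of z] by (simp add: eq_neg_iff_add_eq_0 add.commute)
      then show ?thesis using c[of z] that by (simp add: z0_def algebra_simps)
    qed
    have gq: "\<exists>q. g q \<noteq> 0" by (metis zeros zero_neq_one add_cancel_left_right)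
    then obtain h m where h: "h holomorphic_on UNIV" "h z0 \<noteq> 0" "\<And>z. g z = (z - z0) ^ m * h z"
      using entire_divide_zero[OF hol] by metis
    have "h z \<noteq> 0" for z using zeros[of z] h by (cases "z = z0") auto
    then obtain \<gamma> where \<gamma>: "\<gamma> holomorphic_on UNIV" "\<And>z. h z = exp (\<gamma> z)"
      using contractible_imp_holomorphic_log[OF h(1) contractible_UNIV] by auto
    have "exp_type (\<lambda>z. exp (\<gamma> z))"
    proof (rule exp_type_exp_quotient[of "\<lambda>z. (z - z0) ^ m" "z0 + 1"])
      show "(\<lambda>z. (z - z0) ^ m) holomorphic_on UNIV" by (intro holomorphic_intros)
      show "exp_type (\<lambda>z. exp (\<gamma> z) * (z - z0) ^ m)"
      proof -
        have "(\<lambda>z. exp (\<gamma> z) * (z - z0) ^ m) = g"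
          by (rule ext) (simp only: h(3) \<gamma>(2) mult.commute)
        then show ?thesis using et by simp
      qed
      show "exp_type (\<lambda>z. (z - z0) ^ m)"
      proof (rule exp_typeI)
        fix z
        have "cmod (z - z0) \<le> exp (cmod z0 + cmod z)"
          using norm_triangle_ineq4[of z z0] exp_ge_add_one_self[of "cmod z0 + cmod z"] by linarith
        then have "cmod ((z - z0) ^ m) \<le> exp (cmod z0 + cmod z) ^ m"
          by (simp add: norm_power power_mono)
        also have "\<dots> = exp (real m * cmod z0 + real m * cmod z)"
          by (simp add: exp_of_nat_mult[symmetric] algebra_simps)
        finally show "cmod ((z - z0) ^ m) \<le> \<dots>" .
      qed simp
    qed (use \<gamma> in auto)
    then obtain p s where ps: "\<And>z. \<gamma> z = p * z + s"
      using affine_of_exp_type_exp[OF \<gamma>(1)] by metis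
    define P where "P = 2 * pi * \<i> / a"
    have "P \<noteq> 0" using False by (simp add: P_def)
    define C where "C = exp (p * z0 + s)"
    define w where "w = exp (p * P)"
    have "C \<noteq> 0" "w \<noteq> 0" by (auto simp: C_def w_def)
    text \<open>Along \<open>z0 + j P\<close> the exponential is constant, so there \<open>g\<close> is linear in \<open>j\<close>
      and at the same time equal to \<open>(j P) ^ m * C * w powi j\<close>.\<close>
    have per: "g (z0 + of_int j * P) = g z0 + of_int j * P" for j
    proof -
      have "a * (z0 + of_int j * P) + b = (a * z0 + b) + of_int j * (2 * pi * \<i>)"
        using False by (simp add: P_def algebra_simps)
      also have "exp \<dots> = exp (a * z0 + b)"
        by (simp add: exp_add exp_eq_1 mult.commute[of _ "2 * pi"] mult.assoc)
      finally show ?thesis by (simp add: c)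
    qed
    have val: "g (z0 + x * P) = (x * P) ^ m * C * exp (x * (p * P))" for x
      by (simp add: h(3) \<gamma>(2) ps C_def exp_add[symmetric] algebra_simps)
    have v1: "g (z0 + P) = P ^ m * C * w" using val[of 1] by (simp add: w_def)
    have v1': "g (z0 - P) = (- P) ^ m * C / w"
      using val[of "-1"] by (simp add: w_def exp_minus divide_inverse)
    have v2: "g (z0 + 2 * P) = (2 * P) ^ m * C * w\<^sup>2"
      using val[of 2] by (simp add: w_def exp_double)
    have v2': "g (z0 - 2 * P) = (- (2 * P)) ^ m * C / w\<^sup>2"
      using val[of "-2"] by (simp add: w_def exp_minus exp_double divide_inverse)
    have l: "g (z0 + P) = g z0 + P" "g (z0 - P) = g z0 - P"
      "g (z0 + 2 * P) = g z0 + 2 * P" "g (z0 - 2 * P) = g z0 - 2 * P"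
      using per[of 1] per[of "-1"] per[of 2] per[of "-2"] by simp_all
    show False
    \<comment> \<open>Multiplying the values at opposite points eliminates \<open>w\<close>. For
      \<open>m = 0\<close> this leaves \<open>C * C = C * C - P * P\<close>; otherwise the pairs at
      distances \<open>P\<close> and \<open>2 * P\<close> leave \<open>4 ^ m = 4\<close>.\<close>
    proof (cases "m = 0")
      case True
      then have "g z0 = C" using val[of 0] by simp
      then have "C * w = C + P" "C / w = C - P" using l v1 v1' True by simp_all
      then have "(C * w) * (C / w) = (C + P) * (C - P)" by simp
      then have "P * P = 0" using \<open>w \<noteq> 0\<close> by (simp add: algebra_simps)
      then show False using \<open>P \<noteq> 0\<close> by simp
    next
      case m0: False
      then have g0: "g z0 = 0" using h(3)[of z0] by simp
      have "P ^ m * C * w = P" "(- P) ^ m * C / w = - P"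
        "(2 * P) ^ m * C * w\<^sup>2 = 2 * P" "(- (2 * P)) ^ m * C / w\<^sup>2 = - (2 * P)"
        using l v1 v1' v2 v2' g0 by simp_all
      then have e1: "(P ^ m * C * w) * ((- P) ^ m * C / w) = - P\<^sup>2"
        and e2: "((2 * P) ^ m * C * w\<^sup>2) * ((- (2 * P)) ^ m * C / w\<^sup>2) = - (4 * P\<^sup>2)"
        by (simp_all add: power2_eq_square)
      have cancel: "(x * C * v) * (y * C / v) = (x * y) * C\<^sup>2" if "v \<noteq> 0" for x y v
        using that by (simp add: power2_eq_square)
      have e1: "(P ^ m * (- P) ^ m) * C\<^sup>2 = - P\<^sup>2"
        using e1 unfolding cancel[OF \<open>w \<noteq> 0\<close>] .
      have "w\<^sup>2 \<noteq> 0" using \<open>w \<noteq> 0\<close> by simp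
      then have "((2 * P) ^ m * (- (2 * P)) ^ m) * C\<^sup>2 = - (4 * P\<^sup>2)"
        using e2 unfolding cancel[OF \<open>w\<^sup>2 \<noteq> 0\<close>] by simp
      moreover have "(2 * P) ^ m * (- (2 * P)) ^ m = 4 ^ m * (P ^ m * (- P) ^ m)"
        unfolding power_mult_distrib[symmetric] by simp
      ultimately have "4 ^ m * ((P ^ m * (- P) ^ m) * C\<^sup>2) = - (4 * P\<^sup>2)"
        by (simp only: mult.assoc)
      then have "4 ^ m = (4 :: complex)" using e1 \<open>P \<noteq> 0\<close> by simp
      then have "cmod (4 ^ m) = 4" by simp
      then have "(4::real) ^ m = 4 ^ 1" by (simp add: norm_power)
      then have "m = 1" by (subst (asm) power_inject_exp) auto
      have "((\<lambda>z. (z - z0) * h z) has_field_derivative 1 * h z0 + (z0 - z0) * deriv h z0) (at z0)"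
        using h(1) holomorphic_derivI[of h UNIV z0] by (auto intro!: derivative_eq_intros)
      moreover have "(\<lambda>z. (z - z0) * h z) = g"
        by (rule ext) (simp add: h(3) \<open>m = 1\<close>)
      ultimately have "(g has_field_derivative h z0) (at z0)" by simp
      then have "deriv g z0 = h z0" by (rule DERIV_imp_deriv)
      then show False using crit[OF g0] h(2) by simp
    qed
  qed
qed

text \<open>Otherwise the rescalings for \<open>N = n + 2\<close> have a limit \<open>l\<close> to
  which \<open>no_exp_type_derivative_omitting_one\<close> applies. The offset \<open>2\<close>
  secures \<open>1 < N\<close>, which the growth bound requires.\<close>

lemma spherical_deriv_bounded:
  assumes hol: "F holomorphic_on UNIV" and zero: "\<And>z. F z = 0 \<Longrightarrow> deriv F z = 0"
    and one: "\<And>z. deriv F z = 1 \<Longrightarrow> F z = 1"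
  shows "\<exists>M. \<forall>z. cmod (deriv F z) \<le> M * (1 + (cmod (F z))\<^sup>2)"
proof (rule ccontr)
  assume unb: "\<not> (\<exists>M. \<forall>z. cmod (deriv F z) \<le> M * (1 + (cmod (F z))\<^sup>2))"
  have "\<exists>g. g holomorphic_on UNIV \<and> (\<forall>z. g z = 0 \<longrightarrow> deriv g z = 0) \<and>
      (\<forall>z. deriv g z = 1 \<longrightarrow> real (n + 2) \<le> cmod (g z)) \<and> cmod (deriv g 0) = 1 + (cmod (g 0))\<^sup>2 \<and>
      (\<forall>z\<in>cball 0 (real (n + 2)). cmod (deriv g z) \<le> 1 + 4 * (cmod (g z))\<^sup>2)" for n :: nat
  proof -
    have N: "0 < real (n + 2)" by simp
    obtain z0 \<rho> g where g: "0 < \<rho>" "\<rho> * real (n + 2) \<le> 1" "\<And>\<zeta>. g \<zeta> = F (z0 + of_real \<rho> * \<zeta>) / of_real \<rho>"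
      "\<And>\<zeta>. deriv g \<zeta> = deriv F (z0 + of_real \<rho> * \<zeta>)" "g holomorphic_on UNIV"
      "cmod (deriv g 0) = 1 + (cmod (g 0))\<^sup>2"
      "\<And>\<zeta>. \<zeta> \<in> cball 0 (real (n + 2)) \<Longrightarrow> cmod (deriv g \<zeta>) \<le> 1 + 4 * (cmod (g \<zeta>))\<^sup>2"
      by (rule rescaling[OF hol _ unb N], erule zero) (rule that)
    \<comment> \<open>\<open>deriv g z = 1\<close> means \<open>deriv F = 1\<close>, hence
      \<open>F = 1\<close>, at the corresponding point; so \<open>cmod (g z)\<close> is
      \<open>1 / \<rho>\<close>.\<close>
    have "real (n + 2) \<le> cmod (g z)" if "deriv g z = 1" for z
    proof -
      have "cmod (g z) = 1 / \<rho>"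
        using one[of "z0 + of_real \<rho> * z"] that g(1) by (simp add: g(3,4) norm_divide)
      moreover have "real (n + 2) \<le> 1 / \<rho>"
        using g(2) by (simp only: pos_le_divide_eq[OF g(1)] mult.commute)
      ultimately show ?thesis by simp
    qed
    moreover have "deriv g z = 0" if "g z = 0" for z
      using that g(1) zero by (simp add: g(3,4))
    ultimately show ?thesis using g(5-7) by blast
  qed
  then obtain g :: "nat \<Rightarrow> complex \<Rightarrow> complex" where g: "\<And>n. g n holomorphic_on UNIV"
    "\<And>n z. g n z = 0 \<Longrightarrow> deriv (g n) z = 0"
    "\<And>n z. deriv (g n) z = 1 \<Longrightarrow> real (n + 2) \<le> cmod (g n z)"
    "\<And>n. cmod (deriv (g n) 0) = 1 + (cmod (g n 0))\<^sup>2"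
    "\<And>n z. z \<in> cball 0 (real (n + 2)) \<Longrightarrow> cmod (deriv (g n) z) \<le> 1 + 4 * (cmod (g n z))\<^sup>2"
    by metis
  have growth: "cmod (g n z) \<le> exp (40 + 641 * cmod z)" if "2 * cmod z \<le> real n" for n z
    using that by (intro rescaled_growth[OF g(1) _ g(4) g(5)]) auto
  have large: "2 * cmod z \<le> real n" "cmod (g n z) \<le> exp (40 + 641 * R)"
    if "nat \<lceil>2 * R\<rceil> \<le> n" "z \<in> cball 0 R" for R n z
  proof -
    show n: "2 * cmod z \<le> real n" using that by simp
    have "cmod (g n z) \<le> exp (40 + 641 * cmod z)" using n by (rule growth)
    also have "\<dots> \<le> exp (40 + 641 * R)" using that by simp
    finally show "cmod (g n z) \<le> exp (40 + 641 * R)" .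
  qed
  have b1: "\<exists>B n0. \<forall>n\<ge>n0. \<forall>z\<in>cball 0 R. cmod (g n z) \<le> B" for R
    using large(2)[where R = R] by blast
  have "cmod (deriv (g n) z) \<le> 1 + 4 * (exp (40 + 641 * R))\<^sup>2"
    if "nat \<lceil>2 * R\<rceil> \<le> n" "z \<in> cball 0 R" for R n z
  proof -
    have "cmod z \<le> 2 * cmod z" by simp
    then have "z \<in> cball 0 (real (n + 2))" using large(1)[OF that] by (simp del: mult_le_cancel_right1)
    then have "cmod (deriv (g n) z) \<le> 1 + 4 * (cmod (g n z))\<^sup>2" by (rule g(5))
    also have "(cmod (g n z))\<^sup>2 \<le> (exp (40 + 641 * R))\<^sup>2"
      using large(2)[OF that] by (intro power_mono) auto
    finally show ?thesis by simp
  qed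
  then have b2: "\<exists>B n0. \<forall>n\<ge>n0. \<forall>z\<in>cball 0 R. cmod (deriv (g n) z) \<le> B" for R
    by blast
  obtain r l where rl: "strict_mono (r :: nat \<Rightarrow> nat)" "l holomorphic_on UNIV"
    "\<And>K. compact K \<Longrightarrow> uniform_limit K (\<lambda>n. g (r n)) l sequentially"
    "\<And>K. compact K \<Longrightarrow> uniform_limit K (\<lambda>n. deriv (g (r n))) (deriv l) sequentially"
    by (rule normal_limit_with_deriv[OF g(1) b1 b2]) (rule that)
  have rn: "n \<le> r n" for n using rl(1) by (rule seq_suble)
  have "cmod (l z) \<le> exp (40 + 641 * cmod z)" for z
  proof (rule Lim_norm_ubound)
    show "(\<lambda>n. g (r n) z) \<longlonglongrightarrow> l z"
      by (rule tendsto_uniform_limitI[OF rl(3)[of "{z}"]]) auto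
    have "cmod (g (r n) z) \<le> exp (40 + 641 * cmod z)" if "nat \<lceil>2 * cmod z\<rceil> \<le> n" for n
      using rn[of n] that by (intro large(2)) auto
    then show "\<forall>\<^sub>F n in sequentially. cmod (g (r n) z) \<le> exp (40 + 641 * cmod z)"
      unfolding eventually_sequentially by blast
  qed simp
  then have et: "exp_type l" by (rule exp_typeI) simp
  have crit: "deriv l z = 0" if "l z = 0" for z
    by (rule limit_zeros_critical[where g = "\<lambda>n. g (r n)", OF g(1) rl(2-4) _ that], simp_all)
       (erule g(2))
  \<comment> \<open>The normalisation at the origin passes to the limit and keeps \<open>l\<close>
    from being constant.\<close>
  have "(\<lambda>n. cmod (deriv (g (r n)) 0)) \<longlonglongrightarrow> cmod (deriv l 0)"
    by (intro tendsto_norm tendsto_uniform_limitI[OF rl(4)[of "{0}"]]) auto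
  then have "1 \<le> cmod (deriv l 0)"
    by (rule tendsto_lowerbound) (auto simp: g(4))
  then have nz: "deriv l 0 \<noteq> 0" by auto
  have omit: "deriv l p \<noteq> 1" for p
  proof
    assume p: "deriv l p = 1"
    have "deriv l z = 1" for z
    proof (rule limit_attains_omitted_value[where h = "\<lambda>n. deriv (g (r n))" and l = "deriv l" and p = p])
      show "\<exists>m. \<forall>n\<ge>m. \<forall>z\<in>ball 0 R. deriv (g (r n)) z \<noteq> 1" for R
      \<comment> \<open>Points with derivative \<open>1\<close> have values of modulus at least
        \<open>r n + 2\<close>, which for large \<open>n\<close> exceeds the growth bound on the
        ball.\<close>
      proof (intro exI allI impI ballI notI)
        fix n z
        assume n: "nat \<lceil>2 * R\<rceil> + nat \<lceil>exp (40 + 641 * R)\<rceil> \<le> n" and z: "z \<in> ball 0 R"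
          and 1: "deriv (g (r n)) z = 1"
        have "real (r n + 2) \<le> cmod (g (r n) z)" using g(3)[OF 1] .
        also have "\<dots> \<le> exp (40 + 641 * R)" using n z rn[of n] by (intro large(2)) (linarith, simp)
        also have "\<dots> \<le> real n" using n by linarith
        finally show False using rn[of n] by simp
      qed
    qed (use g(1) rl p in \<open>auto intro!: holomorphic_deriv\<close>)
    \<comment> \<open>Now \<open>l\<close> is a translation, and its zero \<open>- l 0\<close> is
      not critical.\<close>
    then have "((\<lambda>z. l z - z) has_field_derivative 0) (at z)" for z
      using holomorphic_derivI[OF rl(2) open_UNIV, of z] by (auto intro!: derivative_eq_intros)
    from deriv_zero_imp_eq[OF this, of "- l 0" 0] have "l (- l 0) = 0" by simp
    then show False using crit \<open>\<And>z. deriv l z = 1\<close> by force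
  qed
  show False by (rule no_exp_type_derivative_omitting_one[OF rl(2) et crit omit nz])
qed

section \<open>The differential equation\<close>

text \<open>The difference \<open>D\<close> satisfies \<open>D' = exp z / a * D\<close>, so it is a
  constant times \<open>exp (exp z / a)\<close>; unless the constant is \<open>0\<close>, this grows
  too fast for exponential type.\<close>

lemma periodic_of_exp_type_solution:
  assumes hol: "\<Phi> holomorphic_on UNIV" and et: "exp_type \<Phi>" and "a \<noteq> 0"
    and ode: "\<And>z. a * deriv \<Phi> z - 1 = exp z * (\<Phi> z - 1)"
  shows "\<Phi> (z + 2 * pi * \<i>) = \<Phi> z"
proof -
  let ?p = "2 * pi * \<i>"
  define D where "D z = \<Phi> (z + ?p) - \<Phi> z" for z
  have d\<Phi>: "(\<Phi> has_field_derivative deriv \<Phi> z) (at z)" for z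
    using hol holomorphic_derivI by blast
  have "((\<lambda>z. \<Phi> (z + ?p)) has_field_derivative deriv \<Phi> (z + ?p)) (at z)" for z
    using d\<Phi>[of "z + ?p"] by (simp add: DERIV_shift)
  then have dD: "(D has_field_derivative deriv \<Phi> (z + ?p) - deriv \<Phi> z) (at z)" for z
    unfolding D_def using d\<Phi> by (intro derivative_intros)
  have d: "deriv \<Phi> z = (1 + exp z * (\<Phi> z - 1)) / a" for z
    using ode[of z] \<open>a \<noteq> 0\<close> by (simp add: field_simps)
  have D': "deriv \<Phi> (z + ?p) - deriv \<Phi> z = exp z / a * D z" for z
    unfolding d D_def exp_add exp_two_pi_i mult_1_right
    by (simp add: algebra_simps diff_divide_distrib add_divide_distrib)
  have dD': "(D has_field_derivative exp z / a * D z) (at z)" for z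
    using dD[of z] by (simp only: D')
  define V where "V z = D z * exp (- exp z / a)" for z
  have "(V has_field_derivative 0) (at z)" for z
    unfolding V_def using \<open>a \<noteq> 0\<close>
    by (auto intro!: derivative_eq_intros dD' simp: field_simps)
  then have V: "V x = V y" for x y by (rule deriv_zero_imp_eq)
  have "exp_type (\<lambda>z. \<Phi> (1 * z + ?p) - \<Phi> z)"
    by (intro exp_type_diff exp_type_affine et)
  then obtain K where K: "0 \<le> K" "\<And>z. cmod (D z) \<le> exp (K * (1 + cmod z))"
    by (auto simp: D_def elim: exp_typeE)
  have "cmod (V 0) \<le> exp (K * (1 + x + cmod (Ln a)) - exp x)" if "0 \<le> x" for x :: real
  proof -
    \<comment> \<open>The shift by \<open>Ln a\<close> makes \<open>exp ?z / a\<close> the positive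
      real number \<open>exp x\<close>.\<close>
    let ?z = "of_real x + Ln a"
    have "exp ?z / a = of_real (exp x)" using \<open>a \<noteq> 0\<close> by (simp add: exp_add exp_of_real)
    then have "cmod (V ?z) = cmod (D ?z) * exp (- exp x)"
      by (simp add: V_def norm_mult)
    also have "cmod ?z \<le> x + cmod (Ln a)"
      using norm_triangle_ineq[of "of_real x" "Ln a"] that by simp
    then have "K * (1 + cmod ?z) \<le> K * (1 + x + cmod (Ln a))"
      using K by (intro mult_left_mono) auto
    then have "exp (K * (1 + cmod ?z)) \<le> exp (K * (1 + x + cmod (Ln a)))"
      by (rule iffD2[OF exp_le_cancel_iff])
    then have "cmod (D ?z) \<le> exp (K * (1 + x + cmod (Ln a)))"
      using K(2)[of ?z] by linarith
    then have "cmod (D ?z) * exp (- exp x) \<le> exp (K * (1 + x + cmod (Ln a))) * exp (- exp x)"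
      by (intro mult_right_mono) auto
    also have "\<dots> = exp (K * (1 + x + cmod (Ln a)) - exp x)" by (simp add: exp_add[symmetric])
    finally show ?thesis using V[of 0 ?z] by simp
  qed
  then have "\<forall>\<^sub>F x in at_top. cmod (V 0) \<le> exp (K * (1 + x + cmod (Ln a)) - exp x)"
    by (rule eventually_mono[OF eventually_ge_at_top])
  moreover have "((\<lambda>x::real. exp (K * (1 + x + cmod (Ln a)) - exp x)) \<longlongrightarrow> 0) at_top"
    by real_asymp
  ultimately have "cmod (V 0) \<le> 0" by (intro tendsto_lowerbound) auto
  then have "V z = 0" using V[of z 0] by simp
  then show ?thesis by (simp add: V_def D_def)
qed

text \<open>\<open>J k\<close> is the integral of \<open>exp (of_nat k * z) * \<Phi> z\<close> over
  a period. Integrating multiples of the equation shows \<open>J (Suc k) \<noteq> 0\<close>;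
  shifting the period to the left, where \<open>exp (of_nat k * z)\<close> outweighs
  \<open>\<Phi>\<close>, shows \<open>J k = 0\<close> for large \<open>k\<close>.\<close>

lemma no_exp_type_solution:
  assumes hol: "\<Phi> holomorphic_on UNIV" and et: "exp_type \<Phi>" and "a \<noteq> 0"
    and ode: "\<And>z. a * deriv \<Phi> z - 1 = exp z * (\<Phi> z - 1)"
  shows False
proof -
  let ?p = "2 * pi * \<i>"
  note per = periodic_of_exp_type_solution[OF assms]
  have d\<Phi>: "(\<Phi> has_field_derivative deriv \<Phi> z) (at z)" for z
    using hol holomorphic_derivI by blast
  have d: "deriv \<Phi> z = (1 + exp z * (\<Phi> z - 1)) / a" for z
    using ode[of z] \<open>a \<noteq> 0\<close> by (simp add: field_simps)
  have eper: "exp (of_nat k * (z + ?p)) = exp (of_nat k * z)" for z and k :: nat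
  proof -
    have "exp (z + ?p) = exp z" by (simp add: exp_add exp_two_pi_i)
    then show ?thesis by (simp only: exp_of_nat_mult)
  qed
  have "\<exists>\<Psi>. \<forall>z. (\<Psi> has_field_derivative exp (of_nat k * z) * \<Phi> z) (at z)" for k :: nat
  proof -
    have "(\<lambda>z. exp (of_nat k * z) * \<Phi> z) holomorphic_on UNIV"
      by (intro holomorphic_intros hol)
    from holomorphic_convex_primitive'[OF convex_UNIV open_UNIV this] show ?thesis by auto
  qed
  then obtain \<Psi> where \<Psi>: "\<And>k z. (\<Psi> k has_field_derivative exp (of_nat k * z) * \<Phi> z) (at z)"
    by metis
  \<comment> \<open>Increments of primitives stand for the integrals; periodicity of the integrand
    makes them independent of the starting point.\<close>
  define J where "J k = \<Psi> k ?p - \<Psi> k 0" for k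
  have J: "\<Psi> k (z + ?p) = \<Psi> k z + J k" for k z
  proof -
    have "((\<lambda>z. \<Psi> k (z + ?p)) has_field_derivative exp (of_nat k * (z + ?p)) * \<Phi> (z + ?p)) (at z)" for z
      using \<Psi>[of k "z + ?p"] by (simp only: DERIV_shift)
    then have "((\<lambda>z. \<Psi> k (z + ?p) - \<Psi> k z) has_field_derivative
        exp (of_nat k * z) * \<Phi> z - exp (of_nat k * z) * \<Phi> z) (at z)" for z
      using \<Psi>[of k z] unfolding eper per by (rule DERIV_diff)
    then have "((\<lambda>z. \<Psi> k (z + ?p) - \<Psi> k z) has_field_derivative 0) (at z)" for z by simp
    from deriv_zero_imp_eq[OF this, of z 0] show ?thesis by (simp add: J_def algebra_simps)
  qed
  have J1: "J 1 = - ?p"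
  proof -
    \<comment> \<open>This is the integrated equation. Over a period only \<open>z\<close> and
      \<open>\<Psi> 1\<close> change.\<close>
    have "((\<lambda>z. a * \<Phi> z - z - \<Psi> 1 z + exp z) has_field_derivative 0) (at z)" for z
      using \<open>a \<noteq> 0\<close>
      by (auto intro!: derivative_eq_intros d\<Phi> \<Psi> simp: d algebra_simps diff_divide_distrib add_divide_distrib)
    from deriv_zero_imp_eq[OF this, of ?p 0] have "- J 1 = ?p"
      using J[of 1 0] per[of 0] by simp
    then show ?thesis by (metis minus_minus)
  qed
  have Jrec: "J (Suc k) = - (of_nat k * a) * J k" if "k \<noteq> 0" for k
  proof -
    \<comment> \<open>Up to sign, the integral of the equation times
      \<open>exp (of_nat k * z)\<close>, with the term in \<open>deriv \<Phi>\<close> integrated by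
      parts. Only the \<open>\<Psi>\<close> terms change over a period.\<close>
    define V where "V z = of_nat k * a * \<Psi> k z + exp (of_nat k * z) / of_nat k + \<Psi> (Suc k) z
      - exp (of_nat (Suc k) * z) / of_nat (Suc k) - a * (exp (of_nat k * z) * \<Phi> z)" for z
    have e: "exp (of_nat (Suc k) * z) = exp z * exp (of_nat k * z)" for z :: complex
      by (simp add: distrib_right exp_add)
    have n: "of_nat k \<noteq> (0::complex)" "of_nat (Suc k) \<noteq> (0::complex)"
      using that by (simp_all del: of_nat_Suc)
    have "(V has_field_derivative
        of_nat k * a * (exp (of_nat k * z) * \<Phi> z) + exp (of_nat k * z)
        + exp (of_nat (Suc k) * z) * \<Phi> z - exp (of_nat (Suc k) * z)
        - a * (of_nat k * exp (of_nat k * z) * \<Phi> z + exp (of_nat k * z) * deriv \<Phi> z)) (at z)" for z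
      unfolding V_def using n
      by (auto intro!: derivative_eq_intros d\<Phi> \<Psi> simp del: of_nat_Suc simp: algebra_simps)
    then have "(V has_field_derivative 0) (at z)" for z
      using \<open>a \<noteq> 0\<close> unfolding e d by (simp add: algebra_simps diff_divide_distrib add_divide_distrib)
    from deriv_zero_imp_eq[OF this, of "0 + ?p" 0]
    have "of_nat k * a * J k + J (Suc k) = 0"
      unfolding V_def J eper per by (simp add: algebra_simps)
    then show ?thesis by (simp add: eq_neg_iff_add_eq_0 add.commute)
  qed
  have Jnz: "J (Suc k) \<noteq> 0" for k
  proof (induction k)
    case 0
    then show ?case using J1 by simp
  next
    case (Suc k)
    then show ?case using Jrec[of "Suc k"] \<open>a \<noteq> 0\<close> by (simp del: of_nat_Suc)
  qed
  obtain K where K: "0 \<le> K" "\<And>z. cmod (\<Phi> z) \<le> exp (K * (1 + cmod z))"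
    using exp_typeE[OF et] by metis
  \<comment> \<open>\<open>k > K\<close> makes the bound below decay as the segment moves to the
    left.\<close>
  define k where "k = Suc (nat \<lceil>K\<rceil>)"
  have kK: "K < of_nat k" using K(1) by (simp add: k_def) linarith
  have bound: "cmod (J k) \<le> exp (K * (1 + 2 * pi) - (of_nat k - K) * x) * (2 * pi)" if "0 \<le> x" for x :: real
  proof -
    let ?S = "closed_segment (- of_real x) (- of_real x + ?p)"
    have "cmod (\<Psi> k (- of_real x + ?p) - \<Psi> k (- of_real x))
        \<le> exp (K * (1 + 2 * pi) - (of_nat k - K) * x) * cmod (- of_real x + ?p - - of_real x)"
    proof (rule field_differentiable_bound)
      show "convex ?S" by simp
      show "(\<Psi> k has_field_derivative exp (of_nat k * z) * \<Phi> z) (at z within ?S)" for z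
        using \<Psi> has_field_derivative_at_within by blast
      fix z assume "z \<in> ?S"
      then obtain u where u: "0 \<le> u" "u \<le> 1" "z = - of_real x + of_real u * ?p"
        by (auto simp: closed_segment_def scaleR_conv_of_real algebra_simps)
      have "cmod z \<le> x + u * (2 * pi)"
        unfolding u(3) using norm_triangle_ineq[of "- of_real x" "of_real u * ?p"] u that
        by (simp add: norm_mult)
      also have "u * (2 * pi) \<le> 1 * (2 * pi)" using u by (intro mult_right_mono) auto
      finally have "K * (1 + cmod z) \<le> K * (1 + (x + 2 * pi))"
        using K by (intro mult_left_mono) auto
      then have "exp (K * (1 + cmod z)) \<le> exp (K * (1 + (x + 2 * pi)))"
        by (rule iffD2[OF exp_le_cancel_iff])
      then have "cmod (\<Phi> z) \<le> exp (K * (1 + (x + 2 * pi)))" using K(2)[of z] by linarith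
      moreover have "cmod (exp (of_nat k * z)) = exp (- (of_nat k * x))"
        using u(3) by simp
      ultimately have "cmod (exp (of_nat k * z) * \<Phi> z) \<le> exp (- (of_nat k * x)) * exp (K * (1 + (x + 2 * pi)))"
        unfolding norm_mult by (simp add: mult_left_mono)
      also have "\<dots> = exp (K * (1 + 2 * pi) - (of_nat k - K) * x)"
        unfolding exp_add[symmetric] by (simp add: algebra_simps)
      finally show "cmod (exp (of_nat k * z) * \<Phi> z) \<le> \<dots>" .
    qed auto
    then show ?thesis unfolding J by (simp add: norm_mult)
  qed
  have "\<forall>\<^sub>F x in at_top. cmod (J k) \<le> exp (K * (1 + 2 * pi) - (of_nat k - K) * x) * (2 * pi)"
    by (rule eventually_mono[OF eventually_ge_at_top bound])
  moreover have "((\<lambda>x::real. exp (K * (1 + 2 * pi) - (of_nat k - K) * x) * (2 * pi)) \<longlongrightarrow> 0) at_top"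
    using kK by real_asymp
  ultimately have "cmod (J k) \<le> 0" by (intro tendsto_lowerbound) auto
  then show False using Jnz unfolding k_def by simp
qed

text \<open>The multiplier \<open>exp (\<alpha> z)\<close> has exponential type, so
  \<open>\<alpha>\<close> is affine. \<open>no_exp_type_solution\<close> excludes a nonzero slope;
  slope \<open>0\<close> leaves a linear equation with constant coefficients, and multiplicity of
  the zeros of \<open>F\<close> forces the coefficient \<open>E\<close> to be
  \<open>1\<close>.\<close>

lemma shared_one_imp_eq_deriv:
  assumes hol: "F holomorphic_on UNIV" and nc: "\<not> F constant_on UNIV"
    and zero: "\<And>z. F z = 0 \<Longrightarrow> deriv F z = 0" and share: "share_CM 1 F (deriv F)"
  shows "deriv F z = F z"
proof -
  have dF: "(F has_field_derivative deriv F z) (at z)" for z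
    using hol holomorphic_derivI by blast
  have holG: "(\<lambda>z. F z - 1) holomorphic_on UNIV" "(\<lambda>z. deriv F z - 1) holomorphic_on UNIV"
    by (intro holomorphic_intros holomorphic_deriv hol; simp)+
  have eq: "F z - 1 = 0 \<longleftrightarrow> deriv F z - 1 = 0" for z using share by (simp add: share_CM_def)
  obtain p where p: "F p - 1 \<noteq> 0" using nc by (auto simp: constant_on_def)
  have "exp_type F"
    using spherical_deriv_bounded[OF hol zero] eq exp_type_of_spherical_deriv_bound[OF hol]
    by (metis eq_iff_diff_eq_0)
  then have et: "exp_type (\<lambda>z. F z - 1)" "exp_type (\<lambda>z. deriv F z - 1)"
    by (intro exp_type_diff exp_type_deriv exp_type_const hol; assumption)+
  have q: "deriv F p - 1 \<noteq> 0" using p eq by blast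
  obtain \<alpha> where \<alpha>: "\<alpha> holomorphic_on UNIV" "\<And>z. deriv F z - 1 = exp (\<alpha> z) * (F z - 1)"
    using entire_same_zeros_exp_quotient[OF holG(1) p holG(2) q eq] share
    unfolding share_CM_def by blast
  have "exp_type (\<lambda>z. exp (\<alpha> z))"
    by (rule exp_type_exp_quotient[OF holG(1) p \<alpha>(1) et(1)]) (simp only: \<alpha>(2)[symmetric] et(2))
  then obtain a b where ab: "\<And>z. \<alpha> z = a * z + b"
    using affine_of_exp_type_exp[OF \<alpha>(1)] by metis
  have ode: "deriv F z - 1 = exp (a * z + b) * (F z - 1)" for z using \<alpha>(2) ab by simp
  have "a = 0"
  proof (rule ccontr)
    assume a: "a \<noteq> 0"
    \<comment> \<open>The substitution turns the exponent \<open>a * z + b\<close> into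
      \<open>z\<close>, and the chain rule puts the factor \<open>a\<close> before the
      derivative.\<close>
    define \<Phi> where "\<Phi> z = F ((1 / a) * z + (- b / a))" for z
    have d\<Phi>: "(\<Phi> has_field_derivative deriv F ((1 / a) * z + (- b / a)) * (1 / a)) (at z)" for z
      unfolding \<Phi>_def by (rule DERIV_chain2[OF dF]) (use a in \<open>auto intro!: derivative_eq_intros\<close>)
    show False
    proof (rule no_exp_type_solution[OF _ _ a])
      show "\<Phi> holomorphic_on UNIV"
        using d\<Phi> by (auto simp: holomorphic_on_def field_differentiable_def)
      show "exp_type \<Phi>" unfolding \<Phi>_def by (intro exp_type_affine \<open>exp_type F\<close>)
      fix z
      have "a * ((1 / a) * z + (- b / a)) + b = z" using a by (simp add: field_simps)
      then show "a * deriv \<Phi> z - 1 = exp z * (\<Phi> z - 1)"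
        using ode[of "(1 / a) * z + (- b / a)"] a
        unfolding DERIV_imp_deriv[OF d\<Phi>] by (simp add: \<Phi>_def)
    qed
  qed
  define E where "E = exp b"
  have E: "E \<noteq> 0" by (simp add: E_def)
  have ode: "deriv F z - 1 = E * (F z - 1)" for z using ode[of z] \<open>a = 0\<close> by (simp add: E_def)
  define k where "k = (E - 1) / E"
  have F': "deriv F z = E * (F z - k)" for z
  proof -
    have "E * (F z - k) = E * F z - (E - 1)"
      using E by (simp add: k_def right_diff_distrib[of E "F z"])
    moreover have "deriv F z = E * F z - (E - 1)" using ode[of z] by (simp add: algebra_simps)
    ultimately show ?thesis by simp
  qed
  \<comment> \<open>Otherwise \<open>F z = k + A * exp (E * z)\<close> with \<open>k\<close> and
    \<open>A\<close> nonzero has a zero; there \<open>deriv F\<close> vanishes as well, and the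
    equation reads \<open>-1 = - E\<close>.\<close>
  have "E = 1"
  proof (rule ccontr)
    assume E1: "E \<noteq> 1"
    have "((\<lambda>z. (F z - k) * exp (- E * z)) has_field_derivative 0) (at z)" for z
      by (auto intro!: derivative_eq_intros dF simp: F' algebra_simps)
    from deriv_zero_imp_eq[OF this] have
      c: "(F z - k) * exp (- E * z) = (F 0 - k) * exp (- E * 0)" for z by blast
    have "k \<noteq> 0" using E E1 by (simp add: k_def)
    define A where "A = F 0 - k"
    have sol: "F z = k + A * exp (E * z)" for z
    proof -
      have "(F z - k) * (exp (- E * z) * exp (E * z)) = A * exp (E * z)"
        using c[of z] by (simp add: A_def mult.assoc[symmetric])
      moreover have "exp (- E * z) * exp (E * z) = 1" by (simp add: exp_add[symmetric])
      ultimately show ?thesis by (simp add: algebra_simps)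
    qed
    have "A \<noteq> 0" using nc sol by (auto simp: constant_on_def)
    define w where "w = Ln (- k / A) / E"
    have "exp (E * w) = - k / A"
      using \<open>A \<noteq> 0\<close> E \<open>k \<noteq> 0\<close> by (simp add: w_def)
    then have "F w = 0" using \<open>A \<noteq> 0\<close> by (simp add: sol)
    then show False using zero[of w] ode[of w] E1 by simp
  qed
  then show ?thesis using ode[of z] by simp
qed

section \<open>Powers of an entire function\<close>

theorem corollary1:
  fixes f F :: "complex \<Rightarrow> complex" and n :: nat
  assumes "f holomorphic_on UNIV"
    and "\<not> f constant_on UNIV"
    and "n \<ge> 2"
    and "F = (\<lambda>z. f z ^ n)"
    and "share_CM 1 F (deriv F)"
  shows "F = deriv F \<and> (\<exists>c. c \<noteq> 0 \<and> (\<forall>z. f z = c * exp (z / of_nat n)))"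
proof -
  have df: "(f has_field_derivative deriv f z) (at z)" for z
    using assms(1) holomorphic_derivI by blast
  have dF: "deriv F z = of_nat n * f z ^ (n - 1) * deriv f z" for z
    unfolding assms(4) by (rule DERIV_imp_deriv) (auto intro!: derivative_eq_intros df)
  have holF: "F holomorphic_on UNIV" unfolding assms(4) by (intro holomorphic_intros assms(1))
  have const: "f constant_on UNIV" if "\<And>z. deriv f z = 0"
  proof -
    have "(f has_field_derivative 0) (at z)" for z using df[of z] that by simp
    from deriv_zero_imp_eq[OF this] show ?thesis by (auto simp: constant_on_def)
  qed
  \<comment> \<open>If the power is constant, \<open>f\<close> vanishes everywhere or nowhere; in
    the second case \<open>deriv F z = 0\<close> gives \<open>deriv f z = 0\<close>. Both make
    \<open>f\<close> constant.\<close>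
  have ncF: "\<not> F constant_on UNIV"
  proof
    assume "F constant_on UNIV"
    then obtain k where k: "F = (\<lambda>_. k)" by (auto simp: constant_on_def)
    then have "deriv F z = 0" for z by simp
    then have "f z = 0 \<or> deriv f z = 0" for z using dF[of z] assms(3) by auto
    moreover have "f z = 0 \<longleftrightarrow> k = 0" for z
      using fun_cong[OF assms(4), of z] assms(3) by (auto simp: k)
    ultimately show False
      using const assms(2) by (metis constant_on_def)
  qed
  \<comment> \<open>As \<open>n \<ge> 2\<close>, the factor \<open>f z ^ (n - 1)\<close> of
    \<open>deriv F z\<close> vanishes with \<open>f z\<close>.\<close>
  have "deriv F z = 0" if "F z = 0" for z
  proof -
    have "f z = 0" using that assms(3) by (simp add: assms(4))
    then show ?thesis using assms(3) by (simp add: dF power_0_left)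
  qed
  then have FF: "deriv F z = F z" for z
    using shared_one_imp_eq_deriv[OF holF ncF _ assms(5)] by blast
  have "((\<lambda>z. F z * exp (- z)) has_field_derivative 0) (at z)" for z
    using holomorphic_derivI[OF holF open_UNIV, of z]
    by (auto intro!: derivative_eq_intros simp: FF)
  from deriv_zero_imp_eq[OF this] have cF: "F z * exp (- z) = F 0 * exp (- 0)" for z by blast
  have "F z \<noteq> 0" for z
  proof
    assume "F z = 0"
    then have "F 0 = 0" using cF[of z] by simp
    then have "F w = 0" for w using cF[of w] by simp
    then show False using ncF by (auto simp: constant_on_def)
  qed
  then have f0: "f z \<noteq> 0" for z using assms(3,4) by auto
  have f': "deriv f z = f z / of_nat n" for z
  proof -
    have "f z ^ n = f z * f z ^ (n - 1)" using assms(3) by (simp add: power_eq_if)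
    then have "of_nat n * f z ^ (n - 1) * deriv f z = f z * f z ^ (n - 1)"
      using FF[of z] dF[of z] fun_cong[OF assms(4), of z] by simp
    then show ?thesis using f0[of z] assms(3) by (simp add: field_simps)
  qed
  have "((\<lambda>z. f z * exp (- z / of_nat n)) has_field_derivative 0) (at z)" for z
    using assms(3) by (auto intro!: derivative_eq_intros df simp: f')
  from deriv_zero_imp_eq[OF this] have
    cf: "f z * exp (- z / of_nat n) = f 0 * exp (- 0 / of_nat n)" for z by blast
  have "f z = f 0 * exp (z / of_nat n)" for z
  proof -
    have "f z * (exp (- z / of_nat n) * exp (z / of_nat n)) = f 0 * exp (z / of_nat n)"
      using cf[of z] by (simp add: mult.assoc[symmetric])
    then show ?thesis by (simp add: exp_add[symmetric])
  qed
  then show ?thesis using f0 FF by (metis ext)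
qed

end
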